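(* Let $U$ be a nonzero real $n\times m$ matrix and let $\widetilde{U}$ be the matrix whose columns are the columns of $U$ normalized. For all $\varepsilon\in(0,1)$ there exists $\sigma\subset\{1,\dots,m\}$, consisting of indices $j$ with $Ue_j\neq 0$, of size $$|\sigma|\geq \frac{\varepsilon^2}{9}\cdot\frac{\|U\|_{\rm HS}^2}{\|U\|^2}$$ such that $$1-\varepsilon\leq s_{\min}\left(\widetilde{U}_\sigma\right)\leq s_{\max}\left(\widetilde{U}_\sigma\right)\leq 1+\varepsilon.$$ In other terms, for all real $(a_j)_{j\in\sigma}$, $$(1-\varepsilon)\Big(\sum_{j\in\sigma}a_j^2\Big)^{1/2}\leq\Big\|\sum_{j\in\sigma}a_j\frac{Ue_j}{\|Ue_j\|_2}\Big\|_2\leq(1+\varepsilon)\Big(\sum_{j\in\sigma}a_j^2\Big)^{1/2}.$$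
   Context: $(e_j)_{j\le m}$ is the canonical basis of $\mathbb{R}^m$, so $Ue_j$ is the $j$-th column of $U$. $\|U\|_{\rm HS}^2={\rm Tr}(UU^t)$ is the squared Hilbert-Schmidt norm and $\|U\|$ is the operator norm of $U:\ell_2^m\to\ell_2^n$. The $j$-th column of $\widetilde U$ is $Ue_j/\|Ue_j\|_2$ when $Ue_j\ne0$ (zero columns are left equal to $0$). For $\sigma\subset\{1,\dots,m\}$, $\widetilde U_\sigma$ is the restriction of $\widetilde U$ to the columns with indices in $\sigma$, viewed as an operator $\mathbb{R}^\sigma\to\mathbb{R}^n$; $s_{\min}(\widetilde U_\sigma)$ and $s_{\max}(\widetilde U_\sigma)$ are the minimum and maximum of $\|\widetilde U_\sigma x\|_2$ over unit vectors $x\in\mathbb{R}^\sigma$. *)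

theory Defs
  imports "HOL-Analysis.Analysis"
begin

text \<open>An \<open>n \<times> m\<close> matrix has type \<^typ>\<open>real ^ 'm ^ 'n\<close>; the finite types \<open>'m\<close> and \<open>'n\<close> index
  its columns and its rows.\<close>

definition hs_norm_sq :: "real ^ 'm ^ 'n \<Rightarrow> real" where
  "hs_norm_sq U = trace (U ** transpose U)"

definition op_norm :: "real ^ 'm ^ 'n \<Rightarrow> real" where
  "op_norm U = onorm (\<lambda>x. U *v x)"

definition normalize_columns :: "real ^ 'm ^ 'n \<Rightarrow> real ^ 'm ^ 'n" where
  "normalize_columns U =
     (\<chi> i j. if column j U = 0 then 0 else column j U $ i / norm (column j U))"

text \<open>The space \<open>\<real>\<^sup>\<sigma>\<close> is represented by the vectors of \<^typ>\<open>real ^ 'm\<close> supported in \<open>\<sigma>\<close>. On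
  these, \<open>A *v x\<close> only involves the columns of \<open>A\<close> with index in \<open>\<sigma>\<close>, and the norm is the
  Euclidean norm of \<open>\<real>\<^sup>\<sigma>\<close>. So the restriction of \<open>A\<close> to the columns in \<open>\<sigma>\<close> is the map
  \<open>x \<mapsto> A *v x\<close> on this space.\<close>

definition unit_vectors_on :: "'m set \<Rightarrow> (real ^ 'm) set" where
  "unit_vectors_on \<sigma> = {x. (\<forall>j. j \<notin> \<sigma> \<longrightarrow> x $ j = 0) \<and> norm x = 1}"

text \<open>The infimum and the supremum below are attained if \<open>\<sigma>\<close> is nonempty (see
  \<open>s_min_attained\<close> and \<open>s_max_attained\<close>); for empty \<open>\<sigma>\<close> there are no unit vectors and the values
  have no meaning.\<close>

definition s_min :: "real ^ 'm ^ 'n \<Rightarrow> 'm set \<Rightarrow> real" where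
  "s_min A \<sigma> = (INF x\<in>unit_vectors_on \<sigma>. norm (A *v x))"

definition s_max :: "real ^ 'm ^ 'n \<Rightarrow> 'm set \<Rightarrow> real" where
  "s_max A \<sigma> = (SUP x\<in>unit_vectors_on \<sigma>. norm (A *v x))"

lemma column_normalize_columns:
  "column j (normalize_columns U) = (1 / norm (column j U)) *\<^sub>R column j U"
  by (simp add: normalize_columns_def column_def vec_eq_iff)

lemma compact_unit_vectors_on:
  fixes \<sigma> :: "'m::finite set"
  shows "compact (unit_vectors_on \<sigma>)"
proof -
  have "unit_vectors_on \<sigma> = sphere 0 1 \<inter> (\<Inter>j\<in>- \<sigma>. {x. x $ j = 0})"
    by (auto simp: unit_vectors_on_def)
  moreover have "closed (\<Inter>j\<in>- \<sigma>. {x :: real ^ 'm. x $ j = 0})"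
    by (intro closed_INT ballI closed_Collect_eq continuous_intros)
  ultimately show ?thesis
    by (simp add: compact_Int_closed)
qed

lemma unit_vectors_on_nonempty:
  assumes "\<sigma> \<noteq> {}"
  shows "unit_vectors_on \<sigma> \<noteq> {}"
proof -
  obtain j where "j \<in> \<sigma>"
    using assms by blast
  then have "axis j 1 \<in> unit_vectors_on \<sigma>"
    by (auto simp: unit_vectors_on_def axis_def[of j] norm_axis_1[unfolded axis_def])
  then show ?thesis
    by blast
qed

lemma continuous_on_norm_matrix_vector_mult:
  fixes A :: "real ^ 'm ^ 'n"
  shows "continuous_on S (\<lambda>x. norm (A *v x))"
  by (intro continuous_on_norm linear_continuous_on matrix_vector_mul_bounded_linear)

lemma s_min_attained:
  assumes "\<sigma> \<noteq> {}"
  shows "\<exists>x\<in>unit_vectors_on \<sigma>. norm (A *v x) = s_min A \<sigma> \<and>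
           (\<forall>y\<in>unit_vectors_on \<sigma>. s_min A \<sigma> \<le> norm (A *v y))"
proof -
  obtain x where x: "x \<in> unit_vectors_on \<sigma>"
    "\<forall>y\<in>unit_vectors_on \<sigma>. norm (A *v x) \<le> norm (A *v y)"
    using continuous_attains_inf[OF compact_unit_vectors_on
        unit_vectors_on_nonempty[OF assms] continuous_on_norm_matrix_vector_mult] by blast
  then have "s_min A \<sigma> = norm (A *v x)"
    unfolding s_min_def by (intro cInf_eq_minimum) auto
  with x show ?thesis by auto
qed

lemma s_max_attained:
  assumes "\<sigma> \<noteq> {}"
  shows "\<exists>x\<in>unit_vectors_on \<sigma>. norm (A *v x) = s_max A \<sigma> \<and>
           (\<forall>y\<in>unit_vectors_on \<sigma>. norm (A *v y) \<le> s_max A \<sigma>)"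
proof -
  obtain x where x: "x \<in> unit_vectors_on \<sigma>"
    "\<forall>y\<in>unit_vectors_on \<sigma>. norm (A *v y) \<le> norm (A *v x)"
    using continuous_attains_sup[OF compact_unit_vectors_on
        unit_vectors_on_nonempty[OF assms] continuous_on_norm_matrix_vector_mult] by blast
  then have "s_max A \<sigma> = norm (A *v x)"
    unfolding s_max_def by (intro cSup_eq_maximum) auto
  with x show ?thesis by auto
qed

end

theory Submission
  imports Defs
begin

text \<open>
  The columns are chosen greedily. Let \<open>A\<close> be the matrix with normalized columns \<open>A b\<close>, let
  \<open>p b\<close> be the weight \<open>\<parallel>U b\<parallel>\<^sup>2 / \<parallel>U\<parallel>\<^sub>H\<^sub>S\<^sup>2\<close> and let \<open>\<rho> = \<parallel>U\<parallel>\<^sup>2 / \<parallel>U\<parallel>\<^sub>H\<^sub>S\<^sup>2\<close>. The weights form a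
  probability distribution, and a column drawn from it satisfies \<open>E (A b) (A b)\<^sup>t \<le> \<rho> I\<close>. Write
  \<open>G\<close> for the Gram matrix of the columns chosen so far. Its spectrum is kept between a lower
  barrier \<open>s\<close> and an upper barrier \<open>u\<close>, and the quality of the position is measured by the two
  traces \<open>tr (G - s)\<^sup>-\<^sup>1\<close> and \<open>tr (u - G)\<^sup>-\<^sup>1\<close>, in the manner of Batson, Spielman and Srivastava.

  A step moves both barriers outwards by a fixed amount and adds one column. Moving a barrier by
  \<open>\<delta>\<close> replaces the inverse \<open>R\<^sub>0\<close> by some \<open>R\<close> with \<open>tr R + \<delta> tr R\<^sup>2 \<le> tr R\<^sub>0\<close>, by the
  resolvent identity (\<open>inverse_on_shift\<close>). Adding a column borders the matrix by the vector \<open>d\<close> of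
  inner products with the old columns, and increases the trace by \<open>(1 + \<parallel>R d\<parallel>\<^sup>2) / (h - \<langle>R d, d\<rangle>)\<close>,
  where \<open>h\<close> is the distance from the barrier to \<open>1\<close> (\<open>inverse_on_border\<close>). The requirement that
  the trace grows by at most \<open>\<beta>\<close> in the whole step is linear in \<open>d d\<^sup>t\<close>, of the form
  \<open>q(d) \<le> h\<close> with \<open>q \<ge> 0\<close>, and averages of such expressions over the columns are
  bounded by \<open>\<rho>\<close> times traces of functions of \<open>G\<close>. The gain \<open>\<delta> tr R\<^sup>2\<close> of the move pays for the
  term that comes from \<open>\<parallel>R d\<parallel>\<^sup>2\<close> (\<open>barrier_shift_average\<close>).

  For each of the two barriers the average of \<open>q(d) / h\<close> is at most \<open>1/2\<close>, so some column of
  positive weight meets both requirements (\<open>select_next\<close>). A column that is already chosen violates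
  the lower one, so the column is new. This continues as long as the barriers stay
  between \<open>(1 - \<epsilon>)\<^sup>2\<close> and \<open>(1 + \<epsilon>)\<^sup>2\<close>, which allows \<open>\<lceil>\<epsilon>\<^sup>2 / (9 \<rho>)\<rceil>\<close> columns
  (\<open>select_many\<close>).
\<close>

section \<open>Positive operators and their traces\<close>

definition pos_op :: "('a::euclidean_space \<Rightarrow> 'a) \<Rightarrow> bool" where
  "pos_op R \<longleftrightarrow> linear R \<and> (\<forall>x y. R x \<bullet> y = x \<bullet> R y) \<and> (\<forall>x. 0 \<le> R x \<bullet> x)"

definition op_trace :: "('a::euclidean_space \<Rightarrow> 'a) \<Rightarrow> real" where
  "op_trace R = (\<Sum>b\<in>Basis. R b \<bullet> b)"

lemma pos_opD:
  assumes "pos_op R"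
  shows "linear R" "R x \<bullet> y = x \<bullet> R y" "0 \<le> R x \<bullet> x"
  using assms by (auto simp: pos_op_def)

lemma op_trace_nonneg: "pos_op R \<Longrightarrow> 0 \<le> op_trace R"
  unfolding op_trace_def by (intro sum_nonneg pos_opD)

lemma op_trace_square:
  assumes "pos_op R"
  shows "op_trace (\<lambda>x. R (R x)) = (\<Sum>b\<in>Basis. (norm (R b))\<^sup>2)"
  by (simp add: op_trace_def pos_opD[OF assms] power2_norm_eq_inner)

lemma op_trace_combine:
  "op_trace (\<lambda>x. c *\<^sub>R f x + d *\<^sub>R g x) = c * op_trace f + d * op_trace g"
  by (simp add: op_trace_def inner_add_left sum.distrib sum_distrib_left)

lemma op_trace_rank_one: "op_trace (\<lambda>x. (w \<bullet> x) *\<^sub>R w) = (norm w)\<^sup>2"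
  by (simp add: op_trace_def power2_norm_eq_inner euclidean_inner[of w w])

lemma pos_op_cauchy_schwarz:
  assumes "pos_op R"
  shows "(R x \<bullet> y)\<^sup>2 \<le> (R x \<bullet> x) * (R y \<bullet> y)"
proof -
  note R = pos_opD[OF assms]
  have quad: "0 \<le> (R x \<bullet> x) * s\<^sup>2 + 2 * (R x \<bullet> y) * s + R y \<bullet> y" for s
  proof -
    have "0 \<le> R (s *\<^sub>R x + y) \<bullet> (s *\<^sub>R x + y)"
      by (rule R)
    also have "\<dots> = (R x \<bullet> x) * s\<^sup>2 + 2 * (R x \<bullet> y) * s + R y \<bullet> y"
      using R(2)[of x y]
      by (simp add: linear_add[OF R(1)] linear_cmul[OF R(1)] inner_add_left inner_add_right
          inner_commute power2_eq_square algebra_simps)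
    finally show ?thesis .
  qed
  show ?thesis
  proof (cases "R x \<bullet> x = 0")
    case True
    have "R x \<bullet> y = 0"
    proof (rule ccontr)
      assume nz: "R x \<bullet> y \<noteq> 0"
      have "0 \<le> 2 * (R x \<bullet> y) * (- (R y \<bullet> y + 1) / (2 * (R x \<bullet> y))) + R y \<bullet> y"
        using quad[of "- (R y \<bullet> y + 1) / (2 * (R x \<bullet> y))"] True by simp
      with nz show False
        by simp
    qed
    with True show ?thesis by simp
  next
    case False
    then have pos: "0 < R x \<bullet> x"
      using R(3)[of x] by linarith
    have "0 \<le> (R x \<bullet> x) * (- (R x \<bullet> y) / (R x \<bullet> x))\<^sup>2
        + 2 * (R x \<bullet> y) * (- (R x \<bullet> y) / (R x \<bullet> x)) + R y \<bullet> y"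
      by (rule quad)
    also have "\<dots> = R y \<bullet> y - (R x \<bullet> y)\<^sup>2 / (R x \<bullet> x)"
      using pos by (simp add: power2_eq_square field_simps)
    finally show ?thesis
      using pos by (simp add: field_simps)
  qed
qed

text \<open>Coordinate directions are eliminated one at a time: subtracting the rank-one operator
  \<open>x \<mapsto> \<langle>R c, x\<rangle> R c / \<langle>R c, c\<rangle>\<close> leaves the Schur complement, which kills \<open>c\<close>, still kills the
  directions that \<open>R\<close> kills, and is positive by Cauchy-Schwarz. When \<open>\<langle>R c, c\<rangle> = 0\<close>, the same
  inequality shows that \<open>R c = 0\<close> already.\<close>

lemma pos_op_sum_of_squares:
  fixes R :: "'a::euclidean_space \<Rightarrow> 'a"
  assumes "pos_op R"
  shows "\<exists>v :: 'a \<Rightarrow> 'a. \<forall>x. R x = (\<Sum>b\<in>Basis. (v b \<bullet> x) *\<^sub>R v b)"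
proof -
  have "\<exists>v :: 'a \<Rightarrow> 'a. \<forall>x. R x = (\<Sum>b\<in>S. (v b \<bullet> x) *\<^sub>R v b)"
    if "finite S" "pos_op R" "\<forall>b\<in>Basis - S. R b = 0" for S :: "'a set" and R
    using that
  proof (induction S arbitrary: R rule: finite_induct)
    case empty
    then have "linear R"
      by (simp add: pos_opD)
    then have "R x = 0" for x
      using empty linear_eq_0_on_span[of R Basis x] by simp
    then show ?case by simp
  next
    case (insert c S)
    note R = pos_opD[OF insert.prems(1)]
    define q where "q = R c \<bullet> c"
    define w where "w = (1 / sqrt q) *\<^sub>R R c"
    define R1 where "R1 x = R x - (w \<bullet> x) *\<^sub>R w" for x
    have ww: "(w \<bullet> x) *\<^sub>R w = ((R c \<bullet> x) / q) *\<^sub>R R c" if "q \<noteq> 0" for x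
      using R(3)[of c] that by (simp add: w_def q_def flip: real_sqrt_mult)
    have q0: "R c = 0" if "q = 0"
      using pos_op_cauchy_schwarz[OF insert.prems(1), of c "R c"] that
      by (simp add: q_def)
    have "pos_op R1"
      unfolding pos_op_def
    proof (intro conjI allI)
      show "linear R1"
        unfolding R1_def
        by (intro linear_compose_sub R linearI) (auto simp: inner_add_right algebra_simps)
      show "R1 x \<bullet> y = x \<bullet> R1 y" for x y
        using R(2)[of x y] by (simp add: R1_def inner_diff_left inner_diff_right inner_commute)
      show "0 \<le> R1 x \<bullet> x" for x
      proof (cases "q = 0")
        case True
        then show ?thesis using R(3)[of x] q0 by (simp add: R1_def w_def)
      next
        case False
        then have "0 < q"
          using R(3)[of c] by (simp add: q_def)
        then show ?thesis
          using pos_op_cauchy_schwarz[OF insert.prems(1), of c x]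
          by (simp add: R1_def ww inner_diff_left power2_eq_square q_def[symmetric] field_simps)
      qed
    qed
    moreover have "\<forall>b\<in>Basis - S. R1 b = 0"
    proof
      fix b assume b: "b \<in> Basis - S"
      show "R1 b = 0"
      proof (cases "b = c")
        case True
        show ?thesis
        proof (cases "q = 0")
          case True
          then show ?thesis using q0 \<open>b = c\<close> by (simp add: R1_def w_def)
        next
          case False
          then have "(R c \<bullet> c) / q = 1" by (simp add: q_def)
          then show ?thesis using False \<open>b = c\<close> by (simp add: R1_def ww)
        qed
      next
        case False
        then have "R b = 0"
          using b insert.prems(2) by auto
        moreover from this have "R c \<bullet> b = 0"
          using R(2)[of c b] by simp
        ultimately show ?thesis
          by (simp add: R1_def w_def)
      qed
    qed
    ultimately obtain v where v: "\<forall>x. R1 x = (\<Sum>b\<in>S. (v b \<bullet> x) *\<^sub>R v b)"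
      using insert.IH by blast
    have "R x = (\<Sum>b\<in>insert c S. ((v(c := w)) b \<bullet> x) *\<^sub>R (v(c := w)) b)" for x
    proof -
      have "(\<Sum>b\<in>S. ((v(c := w)) b \<bullet> x) *\<^sub>R (v(c := w)) b) = R1 x"
        using v insert.hyps(2) by (auto intro!: sum.cong)
      then show ?thesis
        using insert.hyps by (simp add: R1_def)
    qed
    then show ?case by blast
  qed
  from this[of Basis R] assms show ?thesis by simp
qed

section \<open>Inverses on a subspace\<close>

definition orth_proj :: "('a::euclidean_space \<Rightarrow> 'a) \<Rightarrow> bool" where
  "orth_proj P \<longleftrightarrow> linear P \<and> (\<forall>x y. P x \<bullet> y = x \<bullet> P y) \<and> (\<forall>x. P (P x) = P x)"

text \<open>Inverses of the matrices on a subspace are extended by zero to the orthogonal complement. The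
  Gram matrices of all sets of columns then act on one common space, and the trace of the extended
  inverse is the trace of the inverse on the subspace.\<close>

definition inverse_on :: "('a::euclidean_space \<Rightarrow> 'a) \<Rightarrow> ('a \<Rightarrow> 'a) \<Rightarrow> ('a \<Rightarrow> 'a) \<Rightarrow> bool" where
  "inverse_on P H R \<longleftrightarrow>
     (\<forall>x. H (R x) = P x) \<and> (\<forall>x. R (H x) = P x) \<and> (\<forall>x. P (R x) = R x) \<and> (\<forall>x. R (P x) = R x)"

lemma orth_projD:
  assumes "orth_proj P"
  shows "linear P" "P x \<bullet> y = x \<bullet> P y" "P (P x) = P x"
  using assms by (auto simp: orth_proj_def)

lemma orth_proj_inner: "orth_proj P \<Longrightarrow> P x \<bullet> x = (norm (P x))\<^sup>2"
  by (metis orth_projD(2,3) power2_norm_eq_inner)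

lemma inverse_onD:
  assumes "inverse_on P H R"
  shows "H (R x) = P x" "R (H x) = P x" "P (R x) = R x" "R (P x) = R x"
  using assms by (auto simp: inverse_on_def)

text \<open>The form \<open>\<langle>H x, x\<rangle>\<close> equals \<open>\<langle>R (H x), H x\<rangle>\<close>. Thus positivity of the inverse, which survives
  every step of the selection, certifies the spectral bound.\<close>

lemma form_nonneg_of_inverse:
  assumes P: "orth_proj P" and inv: "inverse_on P H R" and R: "pos_op R"
    and H: "\<And>x y. H x \<bullet> y = x \<bullet> H y" "\<And>x. P (H x) = H x"
  shows "0 \<le> H x \<bullet> x"
proof -
  have "H x \<bullet> x = P (H x) \<bullet> x"
    by (simp add: H)
  also have "\<dots> = H x \<bullet> R (H x)"
    by (simp add: orth_projD(2)[OF P] inverse_onD[OF inv])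
  also have "\<dots> = R (H x) \<bullet> H x"
    by (rule inner_commute)
  finally show ?thesis
    using pos_opD(3)[OF R, of "H x"] by simp
qed

text \<open>A coercive operator on the range of \<open>P\<close> becomes injective on the whole space once the identity
  on the orthogonal complement is added. The sum commutes with \<open>P\<close>, so its inverse does too, and
  composing that inverse with \<open>P\<close> gives the inverse on the range.\<close>

lemma ex_inverse_on:
  fixes H :: "'a::euclidean_space \<Rightarrow> 'a"
  assumes P: "orth_proj P" and lin: "linear H" and H: "\<And>x y. H x \<bullet> y = x \<bullet> H y" "\<And>x. P (H x) = H x"
    and "0 < \<eta>" and coercive: "\<And>x. \<eta> * (norm (P x))\<^sup>2 \<le> H x \<bullet> x"
  shows "\<exists>R. pos_op R \<and> inverse_on P H R"
proof -
  note P' = orth_projD[OF P]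
  have HP: "H (P x) = H x" for x
  proof -
    have "H (P x) \<bullet> y = H x \<bullet> y" for y
      by (metis H P'(2))
    then show ?thesis by (metis vector_eq_rdot)
  qed
  define N where "N x = H x + (x - P x)" for x
  have linN: "linear N"
    unfolding N_def by (intro linear_compose_add linear_compose_sub lin P' linear_ident)
  have "inj N"
    unfolding linear_injective_0[OF linN]
  proof (intro allI impI)
    fix x assume "N x = 0"
    have "P (N x) = H x"
      by (simp add: N_def H linear_add[OF P'(1)] linear_diff[OF P'(1)] P')
    with \<open>N x = 0\<close> have "H x = 0"
      by (simp add: linear_0[OF P'(1)])
    then have "P x = 0"
      using coercive[of x] \<open>0 < \<eta>\<close> by (simp add: mult_le_0_iff)
    with \<open>H x = 0\<close> \<open>N x = 0\<close> show "x = 0"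
      by (simp add: N_def)
  qed
  then obtain M where M: "linear M" "\<And>x. M (N x) = x" "\<And>x. N (M x) = x"
    using linear_injective_isomorphism[OF linN] by blast
  have PN: "P (N x) = H x" "N (P x) = H x" for x
    by (simp_all add: N_def H HP linear_add[OF P'(1)] linear_diff[OF P'(1)] P')
  have PM: "P (M x) = M (P x)" for x
    by (metis M(2,3) PN)
  define R where "R x = M (P x)" for x
  have inv: "inverse_on P H R"
    unfolding inverse_on_def R_def by (metis M(2,3) P'(3) PM PN)
  have symm: "R x \<bullet> y = x \<bullet> R y" for x y
  proof -
    have "R x \<bullet> y = R x \<bullet> H (R y)"
      by (metis inverse_onD(1,3)[OF inv] P'(2))
    also have "\<dots> = H (R x) \<bullet> R y"
      by (simp add: H)
    also have "\<dots> = x \<bullet> R y"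
      by (metis inverse_onD(1,3)[OF inv] P'(2))
    finally show ?thesis .
  qed
  have "0 \<le> R x \<bullet> x" for x
  proof -
    have "R x \<bullet> x = H (R x) \<bullet> R x"
      by (metis inverse_onD(1,3)[OF inv] P'(2) inner_commute)
    moreover have "0 \<le> \<eta> * (norm (P (R x)))\<^sup>2"
      using \<open>0 < \<eta>\<close> by simp
    ultimately show ?thesis
      using coercive[of "R x"] by linarith
  qed
  moreover have "linear R"
    unfolding R_def using linear_compose[OF P'(1) M(1)] by (simp add: o_def)
  ultimately have "pos_op R"
    using symm by (simp add: pos_op_def)
  with inv show ?thesis by blast
qed

text \<open>Since \<open>R = R' + \<delta> R R' = R' + \<delta> R' R\<close>, the difference of the two sides of the trace inequality is
  \<open>\<delta>\<^sup>2 tr (R' R R')\<close>, which is nonnegative because \<open>R\<close> is positive. The extra term \<open>\<delta> tr R'\<^sup>2\<close> is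
  what a move of the barrier gains.\<close>

lemma inverse_on_shift:
  fixes H :: "'a::euclidean_space \<Rightarrow> 'a"
  assumes P: "orth_proj P" and lin: "linear H" and H: "\<And>x y. H x \<bullet> y = x \<bullet> H y" "\<And>x. P (H x) = H x"
    and R: "pos_op R" and inv: "inverse_on P H R" and "0 < \<delta>"
  shows "\<exists>R'. pos_op R' \<and> inverse_on P (\<lambda>x. H x + \<delta> *\<^sub>R P x) R' \<and>
           op_trace R' + \<delta> * op_trace (\<lambda>x. R' (R' x)) \<le> op_trace R"
proof -
  note P' = orth_projD[OF P]
  let ?H = "\<lambda>x. H x + \<delta> *\<^sub>R P x"
  have "\<exists>R'. pos_op R' \<and> inverse_on P ?H R'"
  proof (rule ex_inverse_on[OF P _ _ _ \<open>0 < \<delta>\<close>])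
    show "linear ?H"
      by (intro linear_compose_add lin linear_compose_scale_right P')
    show "?H x \<bullet> y = x \<bullet> ?H y" for x y
      by (simp add: inner_add_left inner_add_right H P')
    show "P (?H x) = ?H x" for x
      by (simp add: linear_add[OF P'(1)] linear_cmul[OF P'(1)] H P')
    show "\<delta> * (norm (P x))\<^sup>2 \<le> ?H x \<bullet> x" for x
      using form_nonneg_of_inverse[OF P inv R H] by (simp add: inner_add_left orth_proj_inner[OF P])
  qed
  then obtain R' where R': "pos_op R'" and inv': "inverse_on P ?H R'"
    by blast
  note linR = pos_opD(1)[OF R] and linR' = pos_opD(1)[OF R']
  (* The resolvent identity, in both orders: the two inverses commute. *)
  have res1: "R x = R' x + \<delta> *\<^sub>R R (R' x)" for x
  proof -
    have "R x = R (?H (R' x))"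
      by (simp only: inverse_onD(1)[OF inv'] inverse_onD(4)[OF inv])
    also have "\<dots> = P (R' x) + \<delta> *\<^sub>R R (R' x)"
      by (simp add: linear_add[OF linR] linear_cmul[OF linR] inverse_onD[OF inv])
    finally show ?thesis by (simp add: inverse_onD[OF inv'])
  qed
  have res2: "R x = R' x + \<delta> *\<^sub>R R' (R x)" for x
  proof -
    have "R x = R' (?H (R x))"
      using inverse_onD(2)[OF inv', of "R x"] inverse_onD(3)[OF inv, of x] by simp
    also have "\<dots> = R' (P x) + \<delta> *\<^sub>R R' (R x)"
      by (simp only: linear_add[OF linR'] linear_cmul[OF linR'] inverse_onD[OF inv])
    finally show ?thesis by (simp add: inverse_onD[OF inv'])
  qed
  have comm: "R (R' x) = R' (R x)" for x
    using res1[of x] res2[of x] \<open>0 < \<delta>\<close> by simp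
  have "op_trace R - op_trace R' - \<delta> * op_trace (\<lambda>x. R' (R' x))
      = (\<Sum>b\<in>Basis. (R b - R' b - \<delta> *\<^sub>R R' (R' b)) \<bullet> b)"
    by (simp add: op_trace_def inner_diff_left sum_subtractf sum_distrib_left)
  also have "\<dots> = (\<Sum>b\<in>Basis. \<delta>\<^sup>2 * (R (R' b) \<bullet> R' b))"
  proof (rule sum.cong[OF refl])
    fix b :: 'a
    have "R b - R' b - \<delta> *\<^sub>R R' (R' b) = \<delta> *\<^sub>R R' (R b) - \<delta> *\<^sub>R R' (R' b)"
      by (metis res2 add_diff_cancel_left')
    also have "\<dots> = \<delta> *\<^sub>R R' (R b - R' b)"
      by (simp add: linear_diff[OF linR'] scaleR_diff_right)
    also have "\<dots> = \<delta> *\<^sub>R R' (\<delta> *\<^sub>R R (R' b))"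
      by (metis res1 add_diff_cancel_left')
    finally have eq: "R b - R' b - \<delta> *\<^sub>R R' (R' b) = \<delta> *\<^sub>R R' (\<delta> *\<^sub>R R (R' b))" .
    show "(R b - R' b - \<delta> *\<^sub>R R' (R' b)) \<bullet> b = \<delta>\<^sup>2 * (R (R' b) \<bullet> R' b)"
      unfolding eq by (simp add: linear_cmul[OF linR'] pos_opD(2)[OF R'] power2_eq_square)
  qed
  also have "\<dots> \<ge> 0"
    by (intro sum_nonneg mult_nonneg_nonneg pos_opD(3)[OF R]) simp
  finally show ?thesis
    using R' inv' by (intro exI[of _ R']) auto
qed

text \<open>Block inversion: the inverse of the bordered operator is the old inverse plus the rank-one
  operator \<open>w w\<^sup>t / s\<close> with \<open>w = R d - e\<close> and the Schur complement \<open>s\<close>, because the bordered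
  operator maps \<open>w\<close> to \<open>- s e\<close>.\<close>

lemma inverse_on_border:
  fixes H :: "'a::euclidean_space \<Rightarrow> 'a"
  assumes P: "orth_proj P" and lin: "linear H" and H: "\<And>x y. H x \<bullet> y = x \<bullet> H y" "\<And>x. P (H x) = H x"
    and R: "pos_op R" and inv: "inverse_on P H R"
    and e: "norm e = 1" "P e = 0" and d: "P d = d" and s: "s = h - R d \<bullet> d" "0 < s"
  shows "\<exists>R'. pos_op R' \<and>
           inverse_on (\<lambda>x. P x + (e \<bullet> x) *\<^sub>R e)
             (\<lambda>x. H x + (d \<bullet> x) *\<^sub>R e + (e \<bullet> x) *\<^sub>R d + (h * (e \<bullet> x)) *\<^sub>R e) R' \<and>
           op_trace R' = op_trace R + (1 + (norm (R d))\<^sup>2) / s"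
proof -
  note P' = orth_projD[OF P]
  note linR = pos_opD(1)[OF R]
  let ?P = "\<lambda>x. P x + (e \<bullet> x) *\<^sub>R e"
  let ?H = "\<lambda>x. H x + (d \<bullet> x) *\<^sub>R e + (e \<bullet> x) *\<^sub>R d + (h * (e \<bullet> x)) *\<^sub>R e"
  define w where "w = R d - e"
  define R' where "R' x = R x + ((w \<bullet> x) / s) *\<^sub>R w" for x
  have ee: "e \<bullet> e = 1"
    using e by (simp add: norm_eq_1)
  have eP: "e \<bullet> P x = 0" for x
    by (metis P'(2) e(2) inner_zero_left)
  have eR: "e \<bullet> R x = 0" for x
    by (metis eP inverse_onD(3)[OF inv])
  have eH: "e \<bullet> H x = 0" for x
    by (metis eP H(2))
  have ed: "e \<bullet> d = 0"
    by (metis eP d)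
  have Re: "R e = 0"
    by (metis e(2) inverse_onD(4)[OF inv] linear_0 linR)
  have He: "H e = 0"
    by (metis eH H(1) inner_commute inner_eq_zero_iff)
  have Pw: "?P w = w"
    by (simp add: w_def linear_diff[OF P'(1)] inverse_onD[OF inv] e inner_diff_right eR ee)
  have Hw: "?H w = - s *\<^sub>R e"
    by (simp add: w_def linear_diff[OF lin] inverse_onD[OF inv] d He eR ee ed inner_diff_right
        inner_commute[of d] s(1) algebra_simps)
  have Hsym: "?H x \<bullet> y = x \<bullet> ?H y" for x y
    using H(1)[of x y]
    by (simp add: inner_add_left inner_add_right inner_commute algebra_simps)
  have HR: "?H (R' x) = ?P x" for x
  proof -
    have "?H (R' x) = ?H (R x) + ((w \<bullet> x) / s) *\<^sub>R ?H w"
      by (simp add: R'_def linear_add[OF lin] linear_cmul[OF lin] inner_add_right algebra_simps)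
    also have "\<dots> = P x + (d \<bullet> R x) *\<^sub>R e - (w \<bullet> x) *\<^sub>R e"
      using s(2) by (subst Hw) (simp add: inverse_onD[OF inv] eR)
    also have "\<dots> = ?P x"
      using pos_opD(2)[OF R, of d x] by (simp add: w_def inner_diff_left algebra_simps)
    finally show ?thesis .
  qed
  have R's: "R' x \<bullet> y = x \<bullet> R' y" for x y
    using pos_opD(2)[OF R, of x y]
    by (simp add: R'_def inner_add_left inner_add_right inner_commute)
  have Psym: "?P x \<bullet> y = x \<bullet> ?P y" for x y
    using P'(2)[of x y] by (simp add: inner_add_left inner_add_right inner_commute)
  have RH: "R' (?H x) = ?P x" for x
  proof -
    have "R' (?H x) \<bullet> y = ?P x \<bullet> y" for y
      by (metis HR Hsym R's Psym)
    then show ?thesis by (metis vector_eq_rdot)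
  qed
  have PR: "?P (R' x) = R' x" for x
  proof -
    have "?P (R' x) = ?P (R x) + ((w \<bullet> x) / s) *\<^sub>R ?P w"
      by (simp add: R'_def linear_add[OF P'(1)] linear_cmul[OF P'(1)] inner_add_right algebra_simps)
    also have "\<dots> = R' x"
      by (subst Pw) (simp add: R'_def inverse_onD[OF inv] eR)
    finally show ?thesis .
  qed
  have RP: "R' (?P x) = R' x" for x
  proof -
    have "R' (?P x) \<bullet> y = R' x \<bullet> y" for y
      by (metis PR R's Psym)
    then show ?thesis by (metis vector_eq_rdot)
  qed
  have "linear R'"
    unfolding R'_def
    by (intro linear_compose_add linR linearI) (auto simp: inner_add_right algebra_simps add_divide_distrib)
  moreover have "0 \<le> R' x \<bullet> x" for x
    using pos_opD(3)[OF R, of x] s(2) by (simp add: R'_def inner_add_left)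
  ultimately have "pos_op R'"
    using R's by (simp add: pos_op_def)
  moreover have "op_trace R' = op_trace R + (1 + (norm (R d))\<^sup>2) / s"
  proof -
    have "R' = (\<lambda>x. 1 *\<^sub>R R x + (1 / s) *\<^sub>R ((w \<bullet> x) *\<^sub>R w))"
      by (simp add: R'_def fun_eq_iff)
    then have "op_trace R' = op_trace R + (norm w)\<^sup>2 / s"
      using op_trace_combine[of 1 R "1 / s" "\<lambda>x. (w \<bullet> x) *\<^sub>R w"] by (simp add: op_trace_rank_one)
    also have "(norm w)\<^sup>2 = 1 + (norm (R d))\<^sup>2"
      by (simp add: w_def power2_norm_eq_inner inner_diff_left inner_diff_right eR ee inner_commute[of "R d" e])
    finally show ?thesis .
  qed
  moreover have "inverse_on ?P ?H R'"
    using HR RH PR RP by (simp add: inverse_on_def)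
  ultimately show ?thesis by blast
qed

section \<open>Coordinate subspaces and Gram operators\<close>

definition coord_proj :: "'a set \<Rightarrow> 'a \<Rightarrow> 'a::euclidean_space" where
  "coord_proj S x = (\<Sum>b\<in>S. (x \<bullet> b) *\<^sub>R b)"

lemma coord_proj_inner_Basis:
  assumes "S \<subseteq> Basis" "c \<in> Basis"
  shows "coord_proj S x \<bullet> c = (if c \<in> S then x \<bullet> c else 0)"
proof -
  have "finite S"
    using finite_subset[OF assms(1) finite_Basis] .
  have "coord_proj S x \<bullet> c = (\<Sum>b\<in>S. if b = c then x \<bullet> b else 0)"
    unfolding coord_proj_def inner_sum_left
  proof (rule sum.cong[OF refl])
    fix b assume "b \<in> S"
    with assms have "b \<bullet> c = (if b = c then 1 else 0)"
      using inner_Basis[of b c] by auto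
    then show "(x \<bullet> b) *\<^sub>R b \<bullet> c = (if b = c then x \<bullet> b else 0)"
      by simp
  qed
  then show ?thesis
    using \<open>finite S\<close> by (simp add: sum.delta')
qed

lemma orth_proj_coord_proj:
  assumes "S \<subseteq> Basis"
  shows "orth_proj (coord_proj S)"
  unfolding orth_proj_def
proof (intro conjI allI)
  show "linear (coord_proj S)"
    by (rule linearI)
      (auto simp: coord_proj_def inner_add_left scaleR_add_left sum.distrib scaleR_right.sum)
  show "coord_proj S x \<bullet> y = x \<bullet> coord_proj S y" for x y
    by (simp add: coord_proj_def inner_sum_left inner_sum_right inner_commute mult.commute)
  show "coord_proj S (coord_proj S x) = coord_proj S x" for x
    by (rule euclidean_eqI) (simp add: coord_proj_inner_Basis assms)
qed

lemma coord_proj_self: "S \<subseteq> Basis \<Longrightarrow> b \<in> S \<Longrightarrow> coord_proj S b = b"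
  by (rule euclidean_eqI) (auto simp: coord_proj_inner_Basis inner_Basis)

lemma coord_proj_other: "S \<subseteq> Basis \<Longrightarrow> b \<in> Basis - S \<Longrightarrow> coord_proj S b = 0"
  by (rule euclidean_eqI) (auto simp: coord_proj_inner_Basis inner_Basis)

lemma coord_proj_insert:
  "finite S \<Longrightarrow> b \<notin> S \<Longrightarrow> coord_proj (insert b S) x = coord_proj S x + (b \<bullet> x) *\<^sub>R b"
  by (simp add: coord_proj_def inner_commute)

lemma op_trace_coord_proj:
  assumes "S \<subseteq> Basis"
  shows "op_trace (coord_proj S) = real (card S)"
proof -
  have "op_trace (coord_proj S) = (\<Sum>b\<in>Basis. if b \<in> S then 1 else 0)"
    unfolding op_trace_def using assms by (intro sum.cong) (auto simp: coord_proj_inner_Basis)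
  also have "\<dots> = real (card (Basis \<inter> S))"
    by (simp add: sum.If_cases)
  finally show ?thesis
    using assms by (simp add: Int_absorb1)
qed

text \<open>The Gram matrix of the columns \<open>A b\<close>, \<open>b \<in> S\<close>, padded by zeros.\<close>

definition gram_op :: "('a::euclidean_space \<Rightarrow> 'b::euclidean_space) \<Rightarrow> 'a set \<Rightarrow> 'a \<Rightarrow> 'a" where
  "gram_op A S x = coord_proj S (adjoint A (A (coord_proj S x)))"

text \<open>The inner products of \<open>A b\<close> with the columns in \<open>S\<close>: the off-diagonal part of the new column
  of the Gram matrix when \<open>b\<close> is added to \<open>S\<close>.\<close>

definition cross_col :: "('a::euclidean_space \<Rightarrow> 'b::euclidean_space) \<Rightarrow> 'a set \<Rightarrow> 'a \<Rightarrow> 'a" where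
  "cross_col A S b = coord_proj S (adjoint A (A b))"

text \<open>The sign \<open>\<omega>\<close> treats both barriers at once: positivity for \<open>\<omega> = 1\<close> says that the spectrum of
  the Gram matrix is above \<open>t\<close>, and for \<open>\<omega> = - 1\<close> that it is below \<open>t\<close>.\<close>

definition barrier_op ::
    "('a::euclidean_space \<Rightarrow> 'b::euclidean_space) \<Rightarrow> real \<Rightarrow> real \<Rightarrow> 'a set \<Rightarrow> 'a \<Rightarrow> 'a" where
  "barrier_op A \<omega> t S x = \<omega> *\<^sub>R (gram_op A S x - t *\<^sub>R coord_proj S x)"

context
  fixes A :: "'a::euclidean_space \<Rightarrow> 'b::euclidean_space" and S :: "'a set"
  assumes A: "linear A" and S: "S \<subseteq> Basis"
begin

lemma adjoint_inner: "adjoint A y \<bullet> x = y \<bullet> A x" "x \<bullet> adjoint A y = A x \<bullet> y"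
  by (metis A adjoint_works inner_commute)+

lemma coord_proj_props: "linear (coord_proj S)" "coord_proj S x \<bullet> y = x \<bullet> coord_proj S y"
    "coord_proj S (coord_proj S x) = coord_proj S x"
  using orth_projD[OF orth_proj_coord_proj[OF S]] by blast+

lemma linear_gram_op: "linear (gram_op A S)"
  using linear_compose[OF linear_compose[OF linear_compose[OF coord_proj_props(1) A] adjoint_linear[OF A]] coord_proj_props(1)]
  by (simp add: o_def gram_op_def[abs_def])

lemma gram_op_inner: "gram_op A S x \<bullet> y = A (coord_proj S x) \<bullet> A (coord_proj S y)"
  by (simp add: gram_op_def coord_proj_props adjoint_inner)

lemma gram_op_commute: "gram_op A S x \<bullet> y = x \<bullet> gram_op A S y"
  by (metis gram_op_inner inner_commute)

lemma cross_col_inner: "cross_col A S b \<bullet> x = A b \<bullet> A (coord_proj S x)"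
  by (simp add: cross_col_def coord_proj_props adjoint_inner)

lemma linear_barrier_op: "linear (barrier_op A \<omega> t S)"
  unfolding barrier_op_def[abs_def]
  by (intro linear_compose_scale_right linear_compose_sub linear_gram_op coord_proj_props)

lemma barrier_op_commute: "barrier_op A \<omega> t S x \<bullet> y = x \<bullet> barrier_op A \<omega> t S y"
  by (simp add: barrier_op_def inner_diff_left inner_diff_right gram_op_commute coord_proj_props)

lemma coord_proj_barrier_op: "coord_proj S (barrier_op A \<omega> t S x) = barrier_op A \<omega> t S x"
  by (simp add: barrier_op_def gram_op_def linear_cmul[OF coord_proj_props(1)] linear_diff[OF coord_proj_props(1)] coord_proj_props)

lemma barrier_op_insert:
  assumes "b \<in> Basis - S" "norm (A b) = 1"
  shows "barrier_op A \<omega> t (insert b S) x =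
     barrier_op A \<omega> t S x + ((\<omega> *\<^sub>R cross_col A S b) \<bullet> x) *\<^sub>R b
       + (b \<bullet> x) *\<^sub>R (\<omega> *\<^sub>R cross_col A S b) + ((\<omega> * (1 - t)) * (b \<bullet> x)) *\<^sub>R b"
proof -
  have ins: "coord_proj (insert b S) y = coord_proj S y + (b \<bullet> y) *\<^sub>R b" for y
    using assms S finite_subset[OF S finite_Basis] by (intro coord_proj_insert) auto
  have nb: "A b \<bullet> A b = 1"
    using assms by (simp add: norm_eq_1)
  have "gram_op A (insert b S) x = gram_op A S x + (cross_col A S b \<bullet> x) *\<^sub>R b
      + (b \<bullet> x) *\<^sub>R cross_col A S b + (b \<bullet> x) *\<^sub>R b"
  proof -
    let ?y = "adjoint A (A (coord_proj (insert b S) x))"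
    have y: "?y = adjoint A (A (coord_proj S x)) + (b \<bullet> x) *\<^sub>R adjoint A (A b)"
      by (simp add: ins linear_add[OF A] linear_cmul[OF A] linear_add[OF adjoint_linear[OF A]]
          linear_cmul[OF adjoint_linear[OF A]])
    have "coord_proj S ?y = gram_op A S x + (b \<bullet> x) *\<^sub>R cross_col A S b"
      by (simp add: y gram_op_def cross_col_def linear_add[OF coord_proj_props(1)] linear_cmul[OF coord_proj_props(1)])
    moreover have "b \<bullet> ?y = cross_col A S b \<bullet> x + (b \<bullet> x)"
      by (simp add: y inner_add_right adjoint_inner cross_col_inner nb)
    ultimately show ?thesis
      by (simp add: gram_op_def ins[of ?y] scaleR_add_left)
  qed
  then show ?thesis
    by (simp add: barrier_op_def ins algebra_simps)
qed

text \<open>On the subspace this is \<open>(G - t)\<^sup>-\<^sup>1 G = 1 + t (G - t)\<^sup>-\<^sup>1\<close>, up to signs. It expresses the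
  averages over the columns by the trace of the inverse and of its square.\<close>

lemma inverse_barrier_op_gram_op:
  assumes sgn: "\<omega> = 1 \<or> \<omega> = - 1" and R: "pos_op R" and inv: "inverse_on (coord_proj S) (barrier_op A \<omega> t S) R"
  shows "R (gram_op A S x) = \<omega> *\<^sub>R coord_proj S x + t *\<^sub>R R x"
proof -
  note linR = pos_opD(1)[OF R]
  have "\<omega> *\<^sub>R coord_proj S x = \<omega> *\<^sub>R R (barrier_op A \<omega> t S x)"
    by (simp add: inverse_onD[OF inv])
  also have "\<dots> = (\<omega> * \<omega>) *\<^sub>R (R (gram_op A S x) - t *\<^sub>R R x)"
    by (simp add: barrier_op_def linear_cmul[OF linR] linear_diff[OF linR] inverse_onD[OF inv])
  also have "\<omega> * \<omega> = 1"
    using sgn by auto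
  finally show ?thesis
    by simp
qed

text \<open>Adding a column twice would create the eigenvalue \<open>0\<close>, below the lower barrier. In terms of the
  quadratic form: for \<open>b \<in> S\<close> the cross vector is \<open>G b\<close>, and
  \<open>\<langle>R G b, G b\<rangle> = 1 + t + t\<^sup>2 \<langle>R b, b\<rangle>\<close>.\<close>

lemma selected_column_form_ge_1:
  assumes R: "pos_op R" and inv: "inverse_on (coord_proj S) (barrier_op A 1 t S) R"
    and b: "b \<in> S" "norm (A b) = 1" and "0 \<le> t"
  shows "1 \<le> R (cross_col A S b) \<bullet> cross_col A S b"
proof -
  have Pb: "coord_proj S b = b"
    using b S by (simp add: coord_proj_self)
  have d: "cross_col A S b = gram_op A S b"
    by (simp add: cross_col_def gram_op_def Pb)
  have nb: "gram_op A S b \<bullet> b = 1" "b \<bullet> b = 1"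
    using b S by (auto simp: gram_op_inner Pb norm_eq_1 inner_Basis)
  have RG: "R (gram_op A S b) = b + t *\<^sub>R R b"
    using inverse_barrier_op_gram_op[OF _ R inv, of b] by (simp add: Pb)
  have "R (gram_op A S b) \<bullet> gram_op A S b = gram_op A S b \<bullet> b + t * (R b \<bullet> gram_op A S b)"
    unfolding RG by (simp add: inner_add_left inner_commute[of b])
  also have "R b \<bullet> gram_op A S b = b \<bullet> (b + t *\<^sub>R R b)"
    by (metis pos_opD(2)[OF R] RG)
  also have "\<dots> = 1 + t * (R b \<bullet> b)"
    by (simp add: inner_add_right nb inner_commute[of b "R b"])
  finally show ?thesis
    using pos_opD(3)[OF R, of b] \<open>0 \<le> t\<close> by (simp add: d nb)
qed

text \<open>The hypothesis is the condition \<open>(1 + \<parallel>R d\<parallel>\<^sup>2) / s \<le> \<phi> - tr R\<close> on the increase of the trace,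
  rearranged so that it is linear in \<open>d d\<^sup>t\<close>. It forces \<open>s > 0\<close>, since its first term is positive.\<close>

lemma barrier_extend:
  assumes sgn: "\<omega> = 1 \<or> \<omega> = - 1" and R: "pos_op R"
    and inv: "inverse_on (coord_proj S) (barrier_op A \<omega> t S) R"
    and b: "b \<in> Basis - S" "norm (A b) = 1" and \<phi>: "op_trace R < \<phi>"
    and test: "(1 + (norm (R (cross_col A S b)))\<^sup>2) / (\<phi> - op_trace R)
        + R (cross_col A S b) \<bullet> cross_col A S b \<le> \<omega> * (1 - t)"
  shows "\<exists>R'. pos_op R' \<and> inverse_on (coord_proj (insert b S)) (barrier_op A \<omega> t (insert b S)) R' \<and>
           op_trace R' \<le> \<phi>"
proof -
  define d where "d = \<omega> *\<^sub>R cross_col A S b"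
  define s where "s = \<omega> * (1 - t) - R d \<bullet> d"
  have \<omega>2: "\<omega> * \<omega> = 1" "\<bar>\<omega>\<bar> = 1"
    using sgn by auto
  have Rd: "R d = \<omega> *\<^sub>R R (cross_col A S b)"
    by (simp add: d_def linear_cmul[OF pos_opD(1)[OF R]])
  have form: "R d \<bullet> d = R (cross_col A S b) \<bullet> cross_col A S b"
    unfolding Rd unfolding d_def using \<omega>2 by (simp add: mult.assoc[symmetric])
  have "norm (R d) = norm (R (cross_col A S b))"
    unfolding Rd using \<omega>2 by simp
  then have le: "(1 + (norm (R d))\<^sup>2) / (\<phi> - op_trace R) \<le> s"
    using test by (simp add: s_def form)
  have num: "0 < 1 + (norm (R d))\<^sup>2"
    by (simp add: add_pos_nonneg)
  have "0 < s"
    using le \<phi> divide_pos_pos[OF num, of "\<phi> - op_trace R"] by simp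
  have "\<exists>R'. pos_op R' \<and>
      inverse_on (\<lambda>x. coord_proj S x + (b \<bullet> x) *\<^sub>R b)
        (\<lambda>x. barrier_op A \<omega> t S x + (d \<bullet> x) *\<^sub>R b + (b \<bullet> x) *\<^sub>R d + (\<omega> * (1 - t) * (b \<bullet> x)) *\<^sub>R b) R' \<and>
      op_trace R' = op_trace R + (1 + (norm (R d))\<^sup>2) / s"
  proof (rule inverse_on_border[OF orth_proj_coord_proj[OF S] linear_barrier_op barrier_op_commute
        coord_proj_barrier_op R inv])
    show "coord_proj S d = d"
      by (simp add: d_def cross_col_def linear_cmul[OF coord_proj_props(1)] coord_proj_props)
    show "coord_proj S b = 0"
      using b S by (simp add: coord_proj_other)
  qed (use b \<open>0 < s\<close> s_def in auto)
  moreover have "(\<lambda>x. coord_proj S x + (b \<bullet> x) *\<^sub>R b) = coord_proj (insert b S)"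
    using b finite_subset[OF S finite_Basis] by (auto simp: coord_proj_insert)
  moreover have "(\<lambda>x. barrier_op A \<omega> t S x + (d \<bullet> x) *\<^sub>R b + (b \<bullet> x) *\<^sub>R d + (\<omega> * (1 - t) * (b \<bullet> x)) *\<^sub>R b)
      = barrier_op A \<omega> t (insert b S)"
    using b by (auto simp: barrier_op_insert d_def)
  moreover have "(1 + (norm (R d))\<^sup>2) / s \<le> \<phi> - op_trace R"
    using le \<open>0 < s\<close> \<phi> by (simp add: field_simps)
  ultimately show ?thesis
    by auto
qed

end

section \<open>Averages over the columns\<close>

text \<open>The weights and the covariance bound are all that the selection uses of the matrix.\<close>

locale weighted_columns =
  fixes A :: "'a::euclidean_space \<Rightarrow> 'b::euclidean_space" and p :: "'a \<Rightarrow> real" and \<rho> :: real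
  assumes linear_A: "linear A"
    and p_nonneg: "b \<in> Basis \<Longrightarrow> 0 \<le> p b"
    and p_sum: "(\<Sum>b\<in>Basis. p b) = 1"
    and unit_col: "b \<in> Basis \<Longrightarrow> 0 < p b \<Longrightarrow> norm (A b) = 1"
    and covariance: "(\<Sum>b\<in>Basis. p b * (A b \<bullet> y)\<^sup>2) \<le> \<rho> * (norm y)\<^sup>2"
begin

lemma ex_pos_weight: "\<exists>b\<in>Basis. 0 < p b"
proof (rule ccontr)
  assume "\<not> (\<exists>b\<in>Basis. 0 < p b)"
  then have "(\<Sum>b\<in>Basis. p b) \<le> 0"
    by (intro sum_nonpos) (auto simp: not_less)
  with p_sum show False by simp
qed

text \<open>A column of positive weight is a unit vector, and it has a positive component along itself, so the
  covariance in its direction does not vanish.\<close>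

lemma rho_pos: "0 < \<rho>"
proof -
  obtain c where c: "c \<in> Basis" "0 < p c"
    using ex_pos_weight by blast
  then have "A c \<bullet> A c = 1" "norm (A c) = 1"
    using unit_col[of c] by (auto simp: norm_eq_1)
  have "0 < p c * (A c \<bullet> A c)\<^sup>2"
    using c \<open>A c \<bullet> A c = 1\<close> by simp
  also have "\<dots> \<le> (\<Sum>b\<in>Basis. p b * (A b \<bullet> A c)\<^sup>2)"
    using c p_nonneg by (intro member_le_sum) auto
  also have "\<dots> \<le> \<rho>"
    using covariance[of "A c"] \<open>norm (A c) = 1\<close> by simp
  finally show ?thesis .
qed

lemma average_cross_col:
  assumes "S \<subseteq> Basis"
  shows "(\<Sum>b\<in>Basis. p b * (cross_col A S b \<bullet> x)\<^sup>2) \<le> \<rho> * (gram_op A S x \<bullet> x)"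
  using covariance[of "A (coord_proj S x)"]
  by (simp add: cross_col_inner[OF linear_A assms] gram_op_inner[OF linear_A assms] power2_norm_eq_inner)

lemma average_sum_of_squares:
  assumes "S \<subseteq> Basis"
  shows "(\<Sum>b\<in>Basis. p b * (\<Sum>c\<in>I. (cross_col A S b \<bullet> v c)\<^sup>2)) \<le> \<rho> * (\<Sum>c\<in>I. gram_op A S (v c) \<bullet> v c)"
proof -
  have "(\<Sum>b\<in>Basis. p b * (\<Sum>c\<in>I. (cross_col A S b \<bullet> v c)\<^sup>2))
      = (\<Sum>c\<in>I. \<Sum>b\<in>Basis. p b * (cross_col A S b \<bullet> v c)\<^sup>2)"
    unfolding sum_distrib_left by (rule sum.swap)
  also have "\<dots> \<le> (\<Sum>c\<in>I. \<rho> * (gram_op A S (v c) \<bullet> v c))"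
    by (intro sum_mono average_cross_col assms)
  finally show ?thesis
    by (simp add: sum_distrib_left)
qed

lemma average_norm:
  assumes S: "S \<subseteq> Basis" and R: "pos_op R"
  shows "(\<Sum>b\<in>Basis. p b * (norm (R (cross_col A S b)))\<^sup>2) \<le> \<rho> * op_trace (\<lambda>x. R (gram_op A S (R x)))"
proof -
  have "(norm (R d))\<^sup>2 = (\<Sum>c\<in>Basis. (d \<bullet> R c)\<^sup>2)" for d
    unfolding power2_norm_eq_inner euclidean_inner[of "R d" "R d"]
    by (simp add: pos_opD(2)[OF R] power2_eq_square)
  then show ?thesis
    using average_sum_of_squares[OF S, where I = Basis and v = R]
    by (simp add: op_trace_def pos_opD(2)[OF R])
qed

text \<open>Writing \<open>R\<close> as a sum of squares reduces the quadratic form to squared inner products with the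
  cross vectors, to which the covariance bound applies.\<close>

lemma average_form:
  assumes S: "S \<subseteq> Basis" and R: "pos_op R"
  shows "(\<Sum>b\<in>Basis. p b * (R (cross_col A S b) \<bullet> cross_col A S b)) \<le> \<rho> * op_trace (\<lambda>x. R (gram_op A S x))"
proof -
  obtain v :: "'a \<Rightarrow> 'a" where v: "\<And>x. R x = (\<Sum>c\<in>Basis. (v c \<bullet> x) *\<^sub>R v c)"
    using pos_op_sum_of_squares[OF R] by blast
  have "R d \<bullet> d = (\<Sum>c\<in>Basis. (d \<bullet> v c)\<^sup>2)" for d
    by (simp add: v inner_sum_left inner_sum_right power2_eq_square inner_commute)
  moreover have "op_trace (\<lambda>x. R (gram_op A S x)) = (\<Sum>c\<in>Basis. gram_op A S (v c) \<bullet> v c)"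
  proof -
    have "op_trace (\<lambda>x. R (gram_op A S x))
        = (\<Sum>b\<in>Basis. \<Sum>c\<in>Basis. (gram_op A S (v c) \<bullet> b) * (v c \<bullet> b))"
      by (simp add: op_trace_def v inner_sum_left gram_op_commute[OF linear_A S])
    also have "\<dots> = (\<Sum>c\<in>Basis. \<Sum>b\<in>Basis. (gram_op A S (v c) \<bullet> b) * (v c \<bullet> b))"
      by (rule sum.swap)
    finally show ?thesis
      by (simp add: euclidean_inner[symmetric])
  qed
  ultimately show ?thesis
    using average_sum_of_squares[OF S, where I = Basis and v = v] by simp
qed

text \<open>A positive inverse of bounded trace witnesses that the spectrum is beyond the barrier \<open>t\<close>, and
  not too close to it.\<close>

definition barrier :: "real \<Rightarrow> real \<Rightarrow> real \<Rightarrow> 'a set \<Rightarrow> bool" where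
  "barrier \<omega> t \<phi> S \<longleftrightarrow>
     (\<exists>R. pos_op R \<and> inverse_on (coord_proj S) (barrier_op A \<omega> t S) R \<and> op_trace R \<le> \<phi>)"

text \<open>With \<open>\<tau> = tr R\<close> and \<open>T = tr R\<^sup>2\<close>, the average is at most
  \<open>(1 + \<rho> (\<omega> \<tau> + t T)) / (\<phi> + \<beta> - \<tau>) + \<rho> (\<omega> |S| + t \<tau>)\<close>. Moving the barrier gave
  \<open>\<tau> + \<delta> T \<le> \<phi>\<close>, so the denominator is at least \<open>\<beta> + \<delta> T\<close>, while the numerator is at most
  \<open>N + \<rho> t T\<close>. The condition \<open>\<rho> t \<beta> \<le> \<delta> N\<close> says that the quotient of these two is largest at
  \<open>T = 0\<close>.\<close>

lemma barrier_shift_average: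
  assumes sgn: "\<omega> = 1 \<or> \<omega> = - 1" and S: "S \<subseteq> Basis"
    and barrier: "barrier \<omega> (t + \<omega> * \<delta>) \<phi> S"
    and pos: "0 < \<delta>" "0 < \<beta>" "0 \<le> t"
    and N: "1 \<le> N" "1 + \<rho> * \<omega> * \<phi> \<le> N" "\<rho> * t * \<beta> \<le> \<delta> * N"
  shows "\<exists>R. pos_op R \<and> inverse_on (coord_proj S) (barrier_op A \<omega> t S) R \<and> op_trace R \<le> \<phi> \<and>
    (\<Sum>b\<in>Basis. p b * ((1 + (norm (R (cross_col A S b)))\<^sup>2) / (\<phi> + \<beta> - op_trace R)
        + R (cross_col A S b) \<bullet> cross_col A S b))
      \<le> N / \<beta> + \<rho> * (\<omega> * real (card S) + t * \<phi>)"
proof -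
  have \<omega>2: "\<omega> * \<omega> = 1"
    using sgn by auto
  obtain R0 where R0: "pos_op R0" "inverse_on (coord_proj S) (barrier_op A \<omega> (t + \<omega> * \<delta>) S) R0"
      "op_trace R0 \<le> \<phi>"
    using barrier by (auto simp: barrier_def)
  have "barrier_op A \<omega> t S = (\<lambda>x. barrier_op A \<omega> (t + \<omega> * \<delta>) S x + \<delta> *\<^sub>R coord_proj S x)"
    using sgn by (auto simp: barrier_op_def algebra_simps)
  then obtain R where R: "pos_op R" and inv: "inverse_on (coord_proj S) (barrier_op A \<omega> t S) R"
    and tr: "op_trace R + \<delta> * op_trace (\<lambda>x. R (R x)) \<le> op_trace R0"
    using inverse_on_shift[OF orth_proj_coord_proj[OF S] linear_barrier_op[OF linear_A S]
        barrier_op_commute[OF linear_A S] coord_proj_barrier_op[OF linear_A S] R0(1,2) \<open>0 < \<delta>\<close>]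
    by auto
  define \<tau> where "\<tau> = op_trace R"
  define T where "T = op_trace (\<lambda>x. R (R x))"
  define \<Delta> where "\<Delta> = \<phi> + \<beta> - \<tau>"
  have T0: "0 \<le> T"
    unfolding T_def by (simp add: op_trace_square[OF R] sum_nonneg)
  have \<tau>0: "0 \<le> \<tau>"
    unfolding \<tau>_def by (rule op_trace_nonneg[OF R])
  have le: "\<tau> + \<delta> * T \<le> \<phi>"
    using tr R0(3) by (simp add: \<tau>_def T_def)
  have \<delta>T: "0 \<le> \<delta> * T"
    using T0 pos by simp
  have \<Delta>: "\<beta> + \<delta> * T \<le> \<Delta>" "0 < \<Delta>"
    using le \<delta>T pos by (auto simp: \<Delta>_def)
  note RG = inverse_barrier_op_gram_op[OF linear_A S sgn R inv]
  have tr1: "op_trace (\<lambda>x. R (gram_op A S x)) = \<omega> * real (card S) + t * \<tau>"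
    by (simp add: RG op_trace_combine op_trace_coord_proj[OF S] \<tau>_def)
  have tr2: "op_trace (\<lambda>x. R (gram_op A S (R x))) = \<omega> * \<tau> + t * T"
    by (simp add: RG inverse_onD[OF inv] op_trace_combine \<tau>_def T_def)
  have "(\<Sum>b\<in>Basis. p b * ((1 + (norm (R (cross_col A S b)))\<^sup>2) / \<Delta> + R (cross_col A S b) \<bullet> cross_col A S b))
      = ((\<Sum>b\<in>Basis. p b) + (\<Sum>b\<in>Basis. p b * (norm (R (cross_col A S b)))\<^sup>2)) / \<Delta>
        + (\<Sum>b\<in>Basis. p b * (R (cross_col A S b) \<bullet> cross_col A S b))"
    by (simp add: sum.distrib[symmetric] sum_divide_distrib algebra_simps add_divide_distrib)
  also have "\<dots> \<le> (1 + \<rho> * (\<omega> * \<tau> + t * T)) / \<Delta> + \<rho> * (\<omega> * real (card S) + t * \<tau>)"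
    using average_norm[OF S R] average_form[OF S R] \<Delta>(2)
    by (intro add_mono divide_right_mono) (auto simp: p_sum tr1 tr2)
  also have "\<dots> \<le> N / \<beta> + \<rho> * (\<omega> * real (card S) + t * \<phi>)"
  proof (intro add_mono)
    have "1 + \<rho> * \<omega> * \<tau> \<le> N"
      using sgn
    proof
      assume "\<omega> = 1"
      moreover have "\<rho> * \<tau> \<le> \<rho> * \<phi>"
        using le \<delta>T rho_pos by (intro mult_left_mono) auto
      ultimately show ?thesis using N(2) by simp
    next
      assume "\<omega> = - 1"
      moreover have "0 \<le> \<rho> * \<tau>"
        using rho_pos \<tau>0 by simp
      ultimately show ?thesis using N(1) by simp
    qed
    moreover have "\<rho> * t * T \<le> N / \<beta> * (\<delta> * T)"
    proof -
      have "\<rho> * t \<le> N * \<delta> / \<beta>"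
        using N(3) pos by (simp add: field_simps)
      from mult_right_mono[OF this T0] show ?thesis
        by (simp add: field_simps)
    qed
    ultimately have "1 + \<rho> * (\<omega> * \<tau> + t * T) \<le> N / \<beta> * (\<beta> + \<delta> * T)"
      using pos by (simp add: algebra_simps)
    also have "\<dots> \<le> N / \<beta> * \<Delta>"
      using \<Delta> N pos by (intro mult_left_mono) auto
    finally show "(1 + \<rho> * (\<omega> * \<tau> + t * T)) / \<Delta> \<le> N / \<beta>"
      using \<Delta>(2) by (simp add: pos_divide_le_eq)
    have "\<rho> * (t * \<tau>) \<le> \<rho> * (t * \<phi>)"
      using le \<delta>T rho_pos pos by (intro mult_left_mono) auto
    then show "\<rho> * (\<omega> * real (card S) + t * \<tau>) \<le> \<rho> * (\<omega> * real (card S) + t * \<phi>)"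
      by (simp add: algebra_simps)
  qed
  finally show ?thesis
    using R inv le \<delta>T by (intro exI[of _ R]) (auto simp: \<Delta>_def \<tau>_def)
qed

text \<open>The two requirements share the budget equally: the sum of the two normalized test quantities has
  average at most \<open>1/2 + 1/2\<close>, so it is at most \<open>1\<close> for some column of positive weight, and both
  summands are nonnegative.\<close>

lemma select_next:
  assumes S: "S \<subseteq> Basis"
    and lo: "barrier 1 (t\<^sub>1 + \<delta>\<^sub>1) \<phi>\<^sub>1 S" "0 < t\<^sub>1" "t\<^sub>1 < 1" "0 < \<delta>\<^sub>1" "0 < \<beta>\<^sub>1" "0 \<le> \<phi>\<^sub>1"
      "\<rho> * t\<^sub>1 * \<beta>\<^sub>1 \<le> \<delta>\<^sub>1"
      "(1 + \<rho> * \<phi>\<^sub>1) / \<beta>\<^sub>1 + \<rho> * (real (card S) + t\<^sub>1 * \<phi>\<^sub>1) \<le> (1 - t\<^sub>1) / 2"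
    and up: "barrier (- 1) (t\<^sub>2 - \<delta>\<^sub>2) \<phi>\<^sub>2 S" "1 < t\<^sub>2" "0 < \<delta>\<^sub>2" "0 < \<beta>\<^sub>2" "0 \<le> \<phi>\<^sub>2"
      "\<rho> * t\<^sub>2 * \<beta>\<^sub>2 \<le> \<delta>\<^sub>2"
      "1 / \<beta>\<^sub>2 + \<rho> * (- real (card S) + t\<^sub>2 * \<phi>\<^sub>2) \<le> (t\<^sub>2 - 1) / 2"
  shows "\<exists>b\<in>Basis - S. 0 < p b \<and> barrier 1 t\<^sub>1 (\<phi>\<^sub>1 + \<beta>\<^sub>1) (insert b S) \<and>
           barrier (- 1) t\<^sub>2 (\<phi>\<^sub>2 + \<beta>\<^sub>2) (insert b S)"
proof -
  have pre1: "(1::real) = 1 \<or> (1::real) = - 1" "barrier 1 (t\<^sub>1 + 1 * \<delta>\<^sub>1) \<phi>\<^sub>1 S" "0 \<le> t\<^sub>1"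
      "1 \<le> 1 + \<rho> * \<phi>\<^sub>1" "1 + \<rho> * 1 * \<phi>\<^sub>1 \<le> 1 + \<rho> * \<phi>\<^sub>1" "\<rho> * t\<^sub>1 * \<beta>\<^sub>1 \<le> \<delta>\<^sub>1 * (1 + \<rho> * \<phi>\<^sub>1)"
  proof -
    have "0 \<le> \<delta>\<^sub>1 * (\<rho> * \<phi>\<^sub>1)"
      using lo rho_pos by simp
    then show "\<rho> * t\<^sub>1 * \<beta>\<^sub>1 \<le> \<delta>\<^sub>1 * (1 + \<rho> * \<phi>\<^sub>1)"
      using lo(7) by (simp add: algebra_simps)
  qed (use lo rho_pos in simp_all)
  obtain R where R: "pos_op R" "inverse_on (coord_proj S) (barrier_op A 1 t\<^sub>1 S) R" "op_trace R \<le> \<phi>\<^sub>1"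
    and avR: "(\<Sum>b\<in>Basis. p b * ((1 + (norm (R (cross_col A S b)))\<^sup>2) / (\<phi>\<^sub>1 + \<beta>\<^sub>1 - op_trace R)
        + R (cross_col A S b) \<bullet> cross_col A S b))
        \<le> (1 + \<rho> * \<phi>\<^sub>1) / \<beta>\<^sub>1 + \<rho> * (1 * real (card S) + t\<^sub>1 * \<phi>\<^sub>1)"
    using barrier_shift_average[OF pre1(1) S pre1(2) lo(4,5) pre1(3-6)] by blast
  have pre2: "(- 1::real) = 1 \<or> (- 1::real) = - 1" "barrier (- 1) (t\<^sub>2 + (- 1) * \<delta>\<^sub>2) \<phi>\<^sub>2 S" "0 \<le> t\<^sub>2"
      "(1::real) \<le> 1" "1 + \<rho> * (- 1) * \<phi>\<^sub>2 \<le> 1" "\<rho> * t\<^sub>2 * \<beta>\<^sub>2 \<le> \<delta>\<^sub>2 * 1"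
    using up rho_pos by simp_all
  obtain Q where Q: "pos_op Q" "inverse_on (coord_proj S) (barrier_op A (- 1) t\<^sub>2 S) Q" "op_trace Q \<le> \<phi>\<^sub>2"
    and avQ: "(\<Sum>b\<in>Basis. p b * ((1 + (norm (Q (cross_col A S b)))\<^sup>2) / (\<phi>\<^sub>2 + \<beta>\<^sub>2 - op_trace Q)
        + Q (cross_col A S b) \<bullet> cross_col A S b))
        \<le> 1 / \<beta>\<^sub>2 + \<rho> * (- 1 * real (card S) + t\<^sub>2 * \<phi>\<^sub>2)"
    using barrier_shift_average[OF pre2(1) S pre2(2) up(3,4) pre2(3-6)] by blast
  define f where "f b = (1 + (norm (R (cross_col A S b)))\<^sup>2) / (\<phi>\<^sub>1 + \<beta>\<^sub>1 - op_trace R)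
        + R (cross_col A S b) \<bullet> cross_col A S b" for b
  define g where "g b = (1 + (norm (Q (cross_col A S b)))\<^sup>2) / (\<phi>\<^sub>2 + \<beta>\<^sub>2 - op_trace Q)
        + Q (cross_col A S b) \<bullet> cross_col A S b" for b
  have avf: "(\<Sum>b\<in>Basis. p b * f b) \<le> (1 - t\<^sub>1) / 2" and avg: "(\<Sum>b\<in>Basis. p b * g b) \<le> (t\<^sub>2 - 1) / 2"
    using avR lo(8) avQ up(7) by (simp_all only: f_def g_def mult_1 mult_minus1 order.trans)
  have f0: "0 \<le> f b" and g0: "0 \<le> g b" for b
    using R Q lo up unfolding f_def g_def
    by (auto intro!: add_nonneg_nonneg divide_nonneg_nonneg pos_opD(3))
  (* Otherwise the average of the sum would exceed the total weight 1. *)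
  have "\<exists>b\<in>Basis. 0 < p b \<and> f b / (1 - t\<^sub>1) + g b / (t\<^sub>2 - 1) \<le> 1"
  proof (rule ccontr)
    assume neg: "\<not> (\<exists>b\<in>Basis. 0 < p b \<and> f b / (1 - t\<^sub>1) + g b / (t\<^sub>2 - 1) \<le> 1)"
    obtain c where c: "c \<in> Basis" "0 < p c"
      using ex_pos_weight by blast
    have "(\<Sum>b\<in>Basis. p b) < (\<Sum>b\<in>Basis. p b * (f b / (1 - t\<^sub>1) + g b / (t\<^sub>2 - 1)))"
    proof (rule sum_strict_mono_ex1)
      show "\<forall>b\<in>Basis. p b \<le> p b * (f b / (1 - t\<^sub>1) + g b / (t\<^sub>2 - 1))"
      proof
        fix b :: 'a assume b: "b \<in> Basis"
        show "p b \<le> p b * (f b / (1 - t\<^sub>1) + g b / (t\<^sub>2 - 1))"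
        proof (cases "p b = 0")
          case False
          then have "0 < p b"
            using p_nonneg[OF b] by simp
          then show ?thesis
            using neg b by (auto simp: not_le)
        qed simp
      qed
      show "\<exists>b\<in>Basis. p b < p b * (f b / (1 - t\<^sub>1) + g b / (t\<^sub>2 - 1))"
        using c neg by (intro bexI[of _ c]) (auto simp: not_le)
    qed simp
    also have "\<dots> = (\<Sum>b\<in>Basis. p b * f b) / (1 - t\<^sub>1) + (\<Sum>b\<in>Basis. p b * g b) / (t\<^sub>2 - 1)"
      by (simp add: sum.distrib sum_divide_distrib distrib_left)
    also have "\<dots> \<le> (1 - t\<^sub>1) / 2 / (1 - t\<^sub>1) + (t\<^sub>2 - 1) / 2 / (t\<^sub>2 - 1)"
      using avf avg lo up by (intro add_mono divide_right_mono) auto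
    also have "\<dots> = 1"
    proof -
      have "x / 2 / x = 1 / 2" if "0 < x" for x :: real
        using that by simp
      moreover have "0 < 1 - t\<^sub>1" "0 < t\<^sub>2 - 1"
        using lo up by auto
      ultimately show ?thesis
        by (simp only:)
    qed
    finally show False
      by (simp add: p_sum)
  qed
  then obtain b where b: "b \<in> Basis" "0 < p b" "f b / (1 - t\<^sub>1) + g b / (t\<^sub>2 - 1) \<le> 1"
    by blast
  have "0 \<le> f b / (1 - t\<^sub>1)" "0 \<le> g b / (t\<^sub>2 - 1)"
    using f0 g0 lo up by auto
  then have "f b / (1 - t\<^sub>1) \<le> 1" "g b / (t\<^sub>2 - 1) \<le> 1"
    using b(3) by linarith+
  then have fb: "f b \<le> 1 - t\<^sub>1" and gb: "g b \<le> t\<^sub>2 - 1"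
    using lo up by auto
  note nb = unit_col[OF b(1,2)]
  have "b \<notin> S"
  proof
    assume "b \<in> S"
    then have "1 \<le> R (cross_col A S b) \<bullet> cross_col A S b"
      using selected_column_form_ge_1[OF linear_A S R(1,2) _ nb] lo by simp
    moreover have "0 \<le> (1 + (norm (R (cross_col A S b)))\<^sup>2) / (\<phi>\<^sub>1 + \<beta>\<^sub>1 - op_trace R)"
      using R lo by simp
    ultimately show False
      using fb lo unfolding f_def by linarith
  qed
  then have bS: "b \<in> Basis - S"
    using b by simp
  have "barrier 1 t\<^sub>1 (\<phi>\<^sub>1 + \<beta>\<^sub>1) (insert b S)"
    unfolding barrier_def
    using fb R lo by (intro barrier_extend[OF linear_A S _ R(1,2) bS nb]) (auto simp: f_def)
  moreover have "barrier (- 1) t\<^sub>2 (\<phi>\<^sub>2 + \<beta>\<^sub>2) (insert b S)"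
    unfolding barrier_def
    using gb Q up by (intro barrier_extend[OF linear_A S _ Q(1,2) bS nb]) (auto simp: g_def)
  ultimately show ?thesis
    using bS b by blast
qed

lemma barrier_empty: "0 \<le> \<phi> \<Longrightarrow> barrier \<omega> t \<phi> {}"
  unfolding barrier_def
  by (intro exI[of _ "\<lambda>x. 0"])
    (simp add: pos_op_def inverse_on_def barrier_op_def gram_op_def coord_proj_def op_trace_def
      module_hom_zero)

lemma barrier_quadratic_form:
  assumes S: "S \<subseteq> Basis" and "barrier \<omega> t \<phi> S" and x: "coord_proj S x = x"
  shows "0 \<le> \<omega> * ((norm (A x))\<^sup>2 - t * (norm x)\<^sup>2)"
proof -
  obtain R where R: "pos_op R" "inverse_on (coord_proj S) (barrier_op A \<omega> t S) R"
    using assms by (auto simp: barrier_def)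
  have "0 \<le> barrier_op A \<omega> t S x \<bullet> x"
    by (rule form_nonneg_of_inverse[OF orth_proj_coord_proj[OF S] R(2,1) barrier_op_commute[OF linear_A S]
          coord_proj_barrier_op[OF linear_A S]])
  then show ?thesis
    by (simp add: barrier_op_def inner_diff_left gram_op_inner[OF linear_A S] x power2_norm_eq_inner)
qed

section \<open>The greedy selection\<close>

text \<open>The barriers for \<open>k\<close> columns are \<open>(1 \<minusplus> \<epsilon>) (1 \<minusplus> z)\<close> with \<open>z = \<gamma> (k - 1)\<close>. The rate \<open>\<gamma>\<close> is
  chosen such that \<open>z\<close> reaches \<open>\<epsilon>\<close> when \<open>k - 1 = \<epsilon>\<^sup>2 / (9 \<rho>)\<close>, which is where the barriers
  reach \<open>(1 \<minusplus> \<epsilon>)\<^sup>2\<close>. The trace budgets grow by \<open>9 / (2 \<epsilon>)\<close> and \<open>9 / (4 \<epsilon>)\<close> per column. The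
  upper one is smaller because the factor \<open>t\<close> that multiplies it in the average exceeds \<open>1\<close>.
  With these constants both averages are at most half the distance of the barrier to \<open>1\<close>
  (the inequalities \<open>avg1\<close> and \<open>avg2\<close>).\<close>

lemma select_many:
  fixes \<epsilon> :: real and k :: nat
  assumes \<epsilon>: "0 < \<epsilon>" "\<epsilon> < 1" and \<gamma>: "\<gamma> = 9 * \<rho> / \<epsilon>" and k: "\<gamma> * (real k - 1) < \<epsilon>"
  shows "\<exists>S\<subseteq>Basis. card S = k \<and> (\<forall>b\<in>S. 0 < p b) \<and>
           barrier 1 ((1 - \<epsilon>) * (1 - \<gamma> * (real k - 1))) (real k * (9 / (2 * \<epsilon>))) S \<and>
           barrier (- 1) ((1 + \<epsilon>) * (1 + \<gamma> * (real k - 1))) (real k * (9 / (4 * \<epsilon>))) S"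
  using k
proof (induction k)
  case 0
  then show ?case
    by (intro exI[of _ "{}"]) (simp add: barrier_empty)
next
  case (Suc k)
  have \<gamma>0: "0 < \<gamma>"
    using \<gamma> rho_pos \<epsilon> by simp
  define z where "z = \<gamma> * real k"
  have z: "0 \<le> z" "z < \<epsilon>"
    using Suc.prems \<gamma>0 by (simp_all add: z_def)
  have "\<gamma> * (real k - 1) < \<epsilon>"
    using z \<gamma>0 by (simp add: z_def algebra_simps)
  then obtain S where S: "S \<subseteq> Basis" "card S = k" "\<forall>b\<in>S. 0 < p b"
    and lo: "barrier 1 ((1 - \<epsilon>) * (1 - \<gamma> * (real k - 1))) (real k * (9 / (2 * \<epsilon>))) S"
    and up: "barrier (- 1) ((1 + \<epsilon>) * (1 + \<gamma> * (real k - 1))) (real k * (9 / (4 * \<epsilon>))) S"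
    using Suc.IH by blast
  have rk: "\<rho> * real k = \<epsilon> * z / 9" "\<rho> * (real k * (9 / (2 * \<epsilon>))) = z / 2"
      "\<rho> * (real k * (9 / (4 * \<epsilon>))) = z / 4"
    using \<epsilon> by (simp_all add: z_def \<gamma> field_simps)
  let ?t1 = "(1 - \<epsilon>) * (1 - z)" and ?t2 = "(1 + \<epsilon>) * (1 + z)"
  have ez: "0 \<le> \<epsilon> * z" "\<epsilon> * z < \<epsilon>" "0 \<le> z * z * (1 - \<epsilon>)" "0 \<le> z * (1 - z) * (1 + \<epsilon>)"
    using z \<epsilon> by auto
  have t: "?t1 = 1 - \<epsilon> - z + \<epsilon> * z" "?t2 = 1 + \<epsilon> + z + \<epsilon> * z"
    by (simp_all add: algebra_simps)
  have avg1: "(1 + z / 2) * (2 * \<epsilon> / 9) + (\<epsilon> * z / 9 + ?t1 * (z / 2)) \<le> (1 - ?t1) / 2"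
  proof -
    have "(1 - ?t1) / 2 - ((1 + z / 2) * (2 * \<epsilon> / 9) + (\<epsilon> * z / 9 + ?t1 * (z / 2)))
        = 5 / 18 * \<epsilon> - 2 / 9 * (\<epsilon> * z) + z * z * (1 - \<epsilon>) / 2"
      by (simp add: field_simps)
    with ez \<epsilon> show ?thesis
      by linarith
  qed
  have avg2: "4 * \<epsilon> / 9 + (- (\<epsilon> * z / 9) + ?t2 * (z / 4)) \<le> (?t2 - 1) / 2"
  proof -
    have "(?t2 - 1) / 2 - (4 * \<epsilon> / 9 + (- (\<epsilon> * z / 9) + ?t2 * (z / 4)))
        = \<epsilon> / 18 + \<epsilon> * z / 9 + z * (1 - z) * (1 + \<epsilon>) / 4"
      by (simp add: field_simps)
    with ez \<epsilon> show ?thesis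
      by linarith
  qed
  have "\<exists>b\<in>Basis - S. 0 < p b \<and>
      barrier 1 ?t1 (real k * (9 / (2 * \<epsilon>)) + 9 / (2 * \<epsilon>)) (insert b S) \<and>
      barrier (- 1) ?t2 (real k * (9 / (4 * \<epsilon>)) + 9 / (4 * \<epsilon>)) (insert b S)"
  proof (rule select_next[OF S(1)])
    show "barrier 1 (?t1 + (1 - \<epsilon>) * \<gamma>) (real k * (9 / (2 * \<epsilon>))) S"
      using lo by (simp add: z_def algebra_simps)
    show "barrier (- 1) (?t2 - (1 + \<epsilon>) * \<gamma>) (real k * (9 / (4 * \<epsilon>))) S"
      using up by (simp add: z_def algebra_simps)
    show "?t1 < 1" "1 < ?t2"
      unfolding t using \<epsilon> z ez by linarith+
    have "\<rho> * ?t1 * (9 / (2 * \<epsilon>)) = (1 - \<epsilon>) * \<gamma> * ((1 - z) / 2)"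
      using \<epsilon> by (simp add: \<gamma> field_simps)
    also have "\<dots> \<le> (1 - \<epsilon>) * \<gamma> * 1"
      using \<epsilon> \<gamma>0 z by (intro mult_left_mono) auto
    finally show "\<rho> * ?t1 * (9 / (2 * \<epsilon>)) \<le> (1 - \<epsilon>) * \<gamma>"
      by simp
    have "\<rho> * ?t2 * (9 / (4 * \<epsilon>)) = (1 + \<epsilon>) * \<gamma> * ((1 + z) / 4)"
      using \<epsilon> by (simp add: \<gamma> field_simps)
    also have "\<dots> \<le> (1 + \<epsilon>) * \<gamma> * 1"
      using \<epsilon> \<gamma>0 z by (intro mult_left_mono) auto
    finally show "\<rho> * ?t2 * (9 / (4 * \<epsilon>)) \<le> (1 + \<epsilon>) * \<gamma>"
      by simp
    have "(1 + \<rho> * (real k * (9 / (2 * \<epsilon>)))) / (9 / (2 * \<epsilon>))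
          + \<rho> * (real (card S) + ?t1 * (real k * (9 / (2 * \<epsilon>))))
        = (1 + z / 2) * (2 * \<epsilon> / 9) + (\<epsilon> * z / 9 + ?t1 * (z / 2))"
      unfolding rk(2)[symmetric] rk(1)[symmetric] S(2) by (simp add: algebra_simps)
    also have "\<dots> \<le> (1 - ?t1) / 2"
      by (rule avg1)
    finally show "(1 + \<rho> * (real k * (9 / (2 * \<epsilon>)))) / (9 / (2 * \<epsilon>))
          + \<rho> * (real (card S) + ?t1 * (real k * (9 / (2 * \<epsilon>)))) \<le> (1 - ?t1) / 2" .
    have "1 / (9 / (4 * \<epsilon>)) + \<rho> * (- real (card S) + ?t2 * (real k * (9 / (4 * \<epsilon>))))
        = 4 * \<epsilon> / 9 + (- (\<epsilon> * z / 9) + ?t2 * (z / 4))"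
      unfolding rk(3)[symmetric] rk(1)[symmetric] S(2) by (simp add: algebra_simps)
    also have "\<dots> \<le> (?t2 - 1) / 2"
      by (rule avg2)
    finally show "1 / (9 / (4 * \<epsilon>)) + \<rho> * (- real (card S) + ?t2 * (real k * (9 / (4 * \<epsilon>))))
        \<le> (?t2 - 1) / 2" .
  qed (use \<epsilon> z \<gamma>0 in auto)
  then obtain b where b: "b \<in> Basis - S" "0 < p b"
      "barrier 1 ?t1 (real k * (9 / (2 * \<epsilon>)) + 9 / (2 * \<epsilon>)) (insert b S)"
      "barrier (- 1) ?t2 (real k * (9 / (4 * \<epsilon>)) + 9 / (4 * \<epsilon>)) (insert b S)"
    by blast
  have succ: "real (Suc k) * c = real k * c + c" "real (Suc k) - 1 = real k" for c :: real
    by (simp_all add: algebra_simps)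
  have "barrier 1 ((1 - \<epsilon>) * (1 - \<gamma> * (real (Suc k) - 1))) (real (Suc k) * (9 / (2 * \<epsilon>))) (insert b S)"
    using b(3) by (simp only: succ z_def)
  moreover have
    "barrier (- 1) ((1 + \<epsilon>) * (1 + \<gamma> * (real (Suc k) - 1))) (real (Suc k) * (9 / (4 * \<epsilon>))) (insert b S)"
    using b(4) by (simp only: succ z_def)
  moreover have "card (insert b S) = Suc k"
    using b(1) S finite_subset[OF S(1) finite_Basis] by simp
  moreover have "insert b S \<subseteq> Basis" "\<forall>c\<in>insert b S. 0 < p c"
    using b S by auto
  ultimately show ?case
    by blast
qed

text \<open>The number of columns is the least integer \<open>k \<ge> \<epsilon>\<^sup>2 / (9 \<rho>)\<close>. The first column is free, as the
  barriers for \<open>k\<close> columns have moved only \<open>k - 1\<close> times past \<open>1 \<minusplus> \<epsilon>\<close>; hence rounding up costs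
  nothing.\<close>

theorem column_selection:
  fixes \<epsilon> :: real
  assumes \<epsilon>: "0 < \<epsilon>" "\<epsilon> < 1"
  shows "\<exists>S\<subseteq>Basis. (\<forall>b\<in>S. 0 < p b) \<and> \<epsilon>\<^sup>2 / 9 / \<rho> \<le> real (card S) \<and>
           (\<forall>x. coord_proj S x = x \<longrightarrow> (1 - \<epsilon>) * norm x \<le> norm (A x) \<and> norm (A x) \<le> (1 + \<epsilon>) * norm x)"
proof -
  define \<gamma> where "\<gamma> = 9 * \<rho> / \<epsilon>"
  have \<gamma>0: "0 < \<gamma>"
    using rho_pos \<epsilon> by (simp add: \<gamma>_def)
  define k where "k = nat \<lceil>\<epsilon>\<^sup>2 / 9 / \<rho>\<rceil>"
  have "0 < \<epsilon>\<^sup>2 / 9 / \<rho>"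
    using rho_pos \<epsilon> by simp
  then have k: "\<epsilon>\<^sup>2 / 9 / \<rho> \<le> real k" "real k - 1 < \<epsilon>\<^sup>2 / 9 / \<rho>"
    unfolding k_def by linarith+
  have "\<gamma> * (real k - 1) < \<gamma> * (\<epsilon>\<^sup>2 / 9 / \<rho>)"
    using k(2) \<gamma>0 by (rule mult_strict_left_mono)
  also have "\<dots> = \<epsilon>"
    using rho_pos \<epsilon> by (simp add: \<gamma>_def power2_eq_square)
  finally have small: "\<gamma> * (real k - 1) < \<epsilon>" .
  then obtain S where S: "S \<subseteq> Basis" "card S = k" "\<forall>b\<in>S. 0 < p b"
    and lo: "barrier 1 ((1 - \<epsilon>) * (1 - \<gamma> * (real k - 1))) (real k * (9 / (2 * \<epsilon>))) S"
    and up: "barrier (- 1) ((1 + \<epsilon>) * (1 + \<gamma> * (real k - 1))) (real k * (9 / (4 * \<epsilon>))) S"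
    using select_many[OF \<epsilon> \<gamma>_def small] by blast
  have "(1 - \<epsilon>) * norm x \<le> norm (A x) \<and> norm (A x) \<le> (1 + \<epsilon>) * norm x" if x: "coord_proj S x = x" for x
  proof
    have "((1 - \<epsilon>) * norm x)\<^sup>2 = (1 - \<epsilon>) * (1 - \<epsilon>) * (norm x)\<^sup>2"
      by (simp add: power2_eq_square)
    also have "\<dots> \<le> (1 - \<epsilon>) * (1 - \<gamma> * (real k - 1)) * (norm x)\<^sup>2"
      using \<epsilon> small by (intro mult_right_mono mult_left_mono) auto
    also have "\<dots> \<le> (norm (A x))\<^sup>2"
      using barrier_quadratic_form[OF S(1) lo x] by simp
    finally show "(1 - \<epsilon>) * norm x \<le> norm (A x)"
      by (rule power2_le_imp_le) simp
    have "(norm (A x))\<^sup>2 \<le> (1 + \<epsilon>) * (1 + \<gamma> * (real k - 1)) * (norm x)\<^sup>2"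
      using barrier_quadratic_form[OF S(1) up x] by simp
    also have "\<dots> \<le> (1 + \<epsilon>) * (1 + \<epsilon>) * (norm x)\<^sup>2"
      using \<epsilon> small by (intro mult_right_mono mult_left_mono) auto
    also have "\<dots> = ((1 + \<epsilon>) * norm x)\<^sup>2"
      by (simp add: power2_eq_square)
    finally show "norm (A x) \<le> (1 + \<epsilon>) * norm x"
      by (rule power2_le_imp_le) (use \<epsilon> in simp)
  qed
  with S k(1) show ?thesis
    by (intro exI[of _ S]) auto
qed

end

section \<open>Normalized columns of a matrix\<close>

lemma Basis_real_vec: "(Basis :: (real ^ 'm) set) = range (\<lambda>j. axis j 1)"
  by (auto simp: Basis_vec_def)

lemma inj_axis_1: "inj (\<lambda>j. axis j (1::real))"
  by (auto simp: inj_on_def axis_eq_axis)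

lemma sum_Basis_real_vec: "(\<Sum>b\<in>(Basis :: (real ^ 'm) set). f b) = (\<Sum>j\<in>UNIV. f (axis j 1))"
  unfolding Basis_real_vec by (simp add: sum.reindex inj_axis_1)

lemma hs_norm_sq_eq_sum_columns: "hs_norm_sq U = (\<Sum>j\<in>UNIV. (norm (column j U))\<^sup>2)"
proof -
  have "hs_norm_sq U = (\<Sum>i\<in>UNIV. \<Sum>j\<in>UNIV. U $ i $ j * U $ i $ j)"
    by (simp add: hs_norm_sq_def trace_def matrix_matrix_mult_def transpose_def)
  also have "\<dots> = (\<Sum>j\<in>UNIV. \<Sum>i\<in>UNIV. U $ i $ j * U $ i $ j)"
    by (rule sum.swap)
  finally show ?thesis
    by (simp add: power2_norm_eq_inner inner_vec_def column_def)
qed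

text \<open>The transpose of a matrix has operator norm at most that of the matrix: apply Cauchy-Schwarz to
  \<open>\<parallel>U\<^sup>t y\<parallel>\<^sup>2 = \<langle>y, U U\<^sup>t y\<rangle>\<close>.\<close>

lemma norm_vector_matrix_mult_le: "norm (y v* U) \<le> op_norm U * norm y"
proof (cases "y v* U = 0")
  case True
  then show ?thesis
    by (simp add: op_norm_def onorm_pos_le)
next
  case False
  have "norm (y v* U) * norm (y v* U) = y \<bullet> (U *v (y v* U))"
    by (simp add: dot_lmul_matrix[symmetric] power2_norm_eq_inner flip: power2_eq_square)
  also have "\<dots> \<le> norm y * norm (U *v (y v* U))"
    by (rule norm_cauchy_schwarz)
  also have "\<dots> \<le> norm y * (op_norm U * norm (y v* U))"
    unfolding op_norm_def by (intro mult_left_mono onorm) auto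
  finally have "norm (y v* U) * norm (y v* U) \<le> (op_norm U * norm y) * norm (y v* U)"
    by (simp add: algebra_simps)
  with False show ?thesis
    by simp
qed

lemma sum_column_inner_square_le: "(\<Sum>j\<in>UNIV. (column j U \<bullet> y)\<^sup>2) \<le> (op_norm U)\<^sup>2 * (norm y)\<^sup>2"
proof -
  have "(y v* U) $ j = column j U \<bullet> y" for j
    by (simp add: vector_matrix_mult_def inner_vec_def column_def mult.commute)
  then have "(\<Sum>j\<in>UNIV. (column j U \<bullet> y)\<^sup>2) = (norm (y v* U))\<^sup>2"
    unfolding power2_norm_eq_inner inner_vec_def[of "y v* U"] by (simp add: power2_eq_square)
  also have "\<dots> \<le> (op_norm U * norm y)\<^sup>2"
    by (intro power_mono norm_vector_matrix_mult_le) simp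
  finally show ?thesis
    by (simp add: power_mult_distrib)
qed

lemma hs_norm_sq_pos: "U \<noteq> 0 \<Longrightarrow> 0 < hs_norm_sq U"
proof -
  assume "U \<noteq> 0"
  then obtain i j where "U $ i $ j \<noteq> 0"
    by (auto simp: vec_eq_iff)
  then have "column j U \<noteq> 0"
    by (auto simp: column_def vec_eq_iff)
  then have "0 < (norm (column j U))\<^sup>2"
    by simp
  also have "\<dots> \<le> hs_norm_sq U"
    unfolding hs_norm_sq_eq_sum_columns by (rule member_le_sum) auto
  finally show ?thesis .
qed

text \<open>Weighting by squared column norms undoes the normalization, so the covariance of the normalized
  columns is \<open>U U\<^sup>t / \<parallel>U\<parallel>\<^sub>H\<^sub>S\<^sup>2\<close>. Zero columns get weight zero and are never selected.\<close>

lemma weighted_columns_normalize: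
  fixes U :: "real ^ 'm ^ 'n"
  assumes "U \<noteq> 0"
  shows "weighted_columns ((*v) (normalize_columns U)) (\<lambda>b. (norm (U *v b))\<^sup>2 / hs_norm_sq U)
    ((op_norm U)\<^sup>2 / hs_norm_sq U)"
proof (rule weighted_columns.intro)
  note pos = hs_norm_sq_pos[OF assms]
  show "linear ((*v) (normalize_columns U))"
    by simp
  show "0 \<le> (norm (U *v b))\<^sup>2 / hs_norm_sq U" for b
    using pos by simp
  show "(\<Sum>b\<in>Basis. (norm (U *v b))\<^sup>2 / hs_norm_sq U) = 1"
    using pos by (simp add: sum_Basis_real_vec matrix_vector_mult_basis hs_norm_sq_eq_sum_columns
        flip: sum_divide_distrib)
  show "norm (normalize_columns U *v b) = 1" if b: "b \<in> Basis" "0 < (norm (U *v b))\<^sup>2 / hs_norm_sq U" for b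
  proof -
    obtain j where "b = axis j 1"
      using b by (auto simp: Basis_real_vec)
    then show ?thesis
      using b by (auto simp: matrix_vector_mult_basis column_normalize_columns)
  qed
  show "(\<Sum>b\<in>Basis. (norm (U *v b))\<^sup>2 / hs_norm_sq U * ((normalize_columns U *v b) \<bullet> y)\<^sup>2)
      \<le> (op_norm U)\<^sup>2 / hs_norm_sq U * (norm y)\<^sup>2" for y
  proof -
    have "(norm (column j U))\<^sup>2 * (column j (normalize_columns U) \<bullet> y)\<^sup>2 = (column j U \<bullet> y)\<^sup>2" for j
      by (cases "column j U = 0") (simp_all add: column_normalize_columns power_divide)
    then have "(\<Sum>b\<in>Basis. (norm (U *v b))\<^sup>2 / hs_norm_sq U * ((normalize_columns U *v b) \<bullet> y)\<^sup>2)
        = (\<Sum>j\<in>UNIV. (column j U \<bullet> y)\<^sup>2) / hs_norm_sq U"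
      by (simp add: sum_Basis_real_vec matrix_vector_mult_basis sum_divide_distrib)
    also have "\<dots> \<le> (op_norm U)\<^sup>2 * (norm y)\<^sup>2 / hs_norm_sq U"
      using pos by (intro divide_right_mono sum_column_inner_square_le) auto
    finally show ?thesis
      by simp
  qed
qed

theorem corollary1p2:
  fixes U :: "real ^ 'm ^ 'n" and \<epsilon> :: real
  assumes "U \<noteq> 0" and "0 < \<epsilon>" and "\<epsilon> < 1"
  shows "\<exists>\<sigma> :: 'm set.
           (\<forall>j\<in>\<sigma>. column j U \<noteq> 0) \<and>
           real (card \<sigma>) \<ge> \<epsilon>\<^sup>2 / 9 * (hs_norm_sq U / (op_norm U)\<^sup>2) \<and>
           1 - \<epsilon> \<le> s_min (normalize_columns U) \<sigma> \<and>
           s_min (normalize_columns U) \<sigma> \<le> s_max (normalize_columns U) \<sigma> \<and>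
           s_max (normalize_columns U) \<sigma> \<le> 1 + \<epsilon> \<and>
           (\<forall>a :: 'm \<Rightarrow> real.
              (1 - \<epsilon>) * sqrt (\<Sum>j\<in>\<sigma>. (a j)\<^sup>2)
                \<le> norm (\<Sum>j\<in>\<sigma>. a j *\<^sub>R ((1 / norm (column j U)) *\<^sub>R column j U)) \<and>
              norm (\<Sum>j\<in>\<sigma>. a j *\<^sub>R ((1 / norm (column j U)) *\<^sub>R column j U))
                \<le> (1 + \<epsilon>) * sqrt (\<Sum>j\<in>\<sigma>. (a j)\<^sup>2))"
proof -
  interpret weighted_columns "(*v) (normalize_columns U)" "\<lambda>b. (norm (U *v b))\<^sup>2 / hs_norm_sq U"
    "(op_norm U)\<^sup>2 / hs_norm_sq U"
    by (rule weighted_columns_normalize) fact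
  note pos = hs_norm_sq_pos[OF assms(1)]
  obtain S :: "(real ^ 'm) set" where S: "S \<subseteq> Basis" "\<forall>b\<in>S. 0 < (norm (U *v b))\<^sup>2 / hs_norm_sq U"
      "\<epsilon>\<^sup>2 / 9 / ((op_norm U)\<^sup>2 / hs_norm_sq U) \<le> real (card S)"
    and bounds: "\<And>x. coord_proj S x = x \<Longrightarrow> (1 - \<epsilon>) * norm x \<le> norm (normalize_columns U *v x)
        \<and> norm (normalize_columns U *v x) \<le> (1 + \<epsilon>) * norm x"
    using column_selection[OF assms(2,3)] by blast
  define \<sigma> where "\<sigma> = {j. axis j (1::real) \<in> S}"
  have S_eq: "S = (\<lambda>j. axis j 1) ` \<sigma>"
    using S(1) by (auto simp: \<sigma>_def Basis_real_vec)
  have card: "card S = card \<sigma>"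
    unfolding S_eq by (intro card_image inj_on_subset[OF inj_axis_1]) auto
  have size: "\<epsilon>\<^sup>2 / 9 * (hs_norm_sq U / (op_norm U)\<^sup>2) \<le> real (card \<sigma>)"
    using S(3) card by simp
  have "0 < \<epsilon>\<^sup>2 / 9 * (hs_norm_sq U / (op_norm U)\<^sup>2)"
    using rho_pos pos assms(2) by (simp add: zero_less_divide_iff)
  with size have "\<sigma> \<noteq> {}"
    by auto
  have cols: "\<forall>j\<in>\<sigma>. column j U \<noteq> 0"
    using S(2) by (auto simp: \<sigma>_def matrix_vector_mult_basis)
  have supported: "coord_proj S x = x" if "\<And>j. j \<notin> \<sigma> \<Longrightarrow> x $ j = 0" for x :: "real ^ 'm"
  proof (rule euclidean_eqI)
    fix b :: "real ^ 'm" assume b: "b \<in> Basis"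
    then obtain j where j: "b = axis j 1"
      by (auto simp: Basis_real_vec)
    show "coord_proj S x \<bullet> b = x \<bullet> b"
      using coord_proj_inner_Basis[OF S(1) b, of x] that[of j]
      by (auto simp: j \<sigma>_def inner_axis split: if_splits)
  qed
  have unit: "1 - \<epsilon> \<le> norm (normalize_columns U *v x)" "norm (normalize_columns U *v x) \<le> 1 + \<epsilon>"
    if "x \<in> unit_vectors_on \<sigma>" for x
    using bounds[OF supported, of x] that by (auto simp: unit_vectors_on_def)
  obtain x y where x: "x \<in> unit_vectors_on \<sigma>" "norm (normalize_columns U *v x) = s_min (normalize_columns U) \<sigma>"
      and y: "y \<in> unit_vectors_on \<sigma>" "norm (normalize_columns U *v y) = s_max (normalize_columns U) \<sigma>"
      and le: "s_min (normalize_columns U) \<sigma> \<le> norm (normalize_columns U *v y)"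
    using s_min_attained[OF \<open>\<sigma> \<noteq> {}\<close>] s_max_attained[OF \<open>\<sigma> \<noteq> {}\<close>] by metis
  have combination: "(1 - \<epsilon>) * sqrt (\<Sum>j\<in>\<sigma>. (a j)\<^sup>2)
          \<le> norm (\<Sum>j\<in>\<sigma>. a j *\<^sub>R ((1 / norm (column j U)) *\<^sub>R column j U)) \<and>
        norm (\<Sum>j\<in>\<sigma>. a j *\<^sub>R ((1 / norm (column j U)) *\<^sub>R column j U))
          \<le> (1 + \<epsilon>) * sqrt (\<Sum>j\<in>\<sigma>. (a j)\<^sup>2)" for a
  proof -
    define v :: "real ^ 'm" where "v = (\<chi> j. if j \<in> \<sigma> then a j else 0)"
    have "norm v = sqrt (\<Sum>j\<in>UNIV. if j \<in> \<sigma> then (a j)\<^sup>2 else 0)"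
      unfolding norm_eq_sqrt_inner inner_vec_def v_def
      by (intro arg_cong[of _ _ sqrt] sum.cong) (auto simp: power2_eq_square)
    then have norm_v: "norm v = sqrt (\<Sum>j\<in>\<sigma>. (a j)\<^sup>2)"
      by (simp add: sum.If_cases)
    have "normalize_columns U *v v = (\<Sum>j\<in>UNIV. v $ j *\<^sub>R column j (normalize_columns U))"
      by (simp add: matrix_mult_sum scalar_mult_eq_scaleR)
    also have "\<dots> = (\<Sum>j\<in>UNIV. if j \<in> \<sigma> then a j *\<^sub>R ((1 / norm (column j U)) *\<^sub>R column j U) else 0)"
      by (intro sum.cong) (auto simp: v_def column_normalize_columns)
    also have "\<dots> = (\<Sum>j\<in>\<sigma>. a j *\<^sub>R ((1 / norm (column j U)) *\<^sub>R column j U))"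
      by (simp add: sum.If_cases)
    finally have image: "normalize_columns U *v v
        = (\<Sum>j\<in>\<sigma>. a j *\<^sub>R ((1 / norm (column j U)) *\<^sub>R column j U))" .
    have "coord_proj S v = v"
      by (rule supported) (simp add: v_def)
    from bounds[OF this] show ?thesis
      unfolding image norm_v .
  qed
  show ?thesis
    using cols size unit(1)[OF x(1)] x(2) y(2) le unit(2)[OF y(1)] combination
    by (intro exI[of _ \<sigma>]) simp
qed

end
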